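(* Let $k \geq 1$ and $n \in \mathbb{N}$, let $\gamma, \beta \in [0,1]$ and let $q$ be a prime power. Every $(k, \gamma q^k, \beta)$-Furstenberg set $K \subseteq \mathbb{F}_q^n$ satisfies $$|K| \geq \beta \gamma^n q^n \left(1 + \frac{1}{q^{k-1}}\right)^{-n}.$$
   Context: $\mathcal{L}_k^*(\mathbb{F}_q^n)$ denotes the set of $k$-dimensional linear subspaces of $\mathbb{F}_q^n$. A flat $R$ is $m$-rich with respect to $K$ if $|R \cap K| \geq m$. A set $K \subset \mathbb{F}_q^n$ is a $(k, m, \beta)$-Furstenberg set if for at least a $\beta$-fraction of all $A \in \mathcal{L}_k^*(\mathbb{F}_q^n)$ there exists $a \in \mathbb{F}_q^n$ such that $a + A$ is $m$-rich with respect to $K$.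
   Formalization: The formal theorem adds the assumption k ≤ n; for k > n there are no k-dimensional subspaces, the Furstenberg condition is vacuous, and the bound fails for the empty set K whenever β, γ > 0. *)

theory Defs
  imports "HOL-Analysis.Analysis"
begin

text \<open>The set of k-dimensional linear subspaces of F^n, with F a finite field
  (so q = CARD('a) is a prime power) and n = CARD('n).\<close>
definition lin_subspaces :: "nat \<Rightarrow> ('a::{field,finite} ^ 'n) set set" where
  "lin_subspaces k = {A. vec.subspace A \<and> vec.dim A = k}"

definition rich :: "real \<Rightarrow> ('a::{field,finite} ^ 'n) set \<Rightarrow> ('a ^ 'n) set \<Rightarrow> bool" where
  "rich m K R \<longleftrightarrow> real (card (R \<inter> K)) \<ge> m"

definition furstenberg :: "nat \<Rightarrow> real \<Rightarrow> real \<Rightarrow> ('a::{field,finite} ^ 'n) set \<Rightarrow> bool" where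
  "furstenberg k m \<beta> K \<longleftrightarrow>
     real (card {A \<in> lin_subspaces k. \<exists>a. rich m K ((\<lambda>x. a + x) ` A)})
       \<ge> \<beta> * real (card (lin_subspaces k :: ('a ^ 'n) set set))"

end

(*
  Method of multiplicities. Consider the polynomials of degree < d in n variables over F_q that
  vanish to order m on K. Restricting such a polynomial to a rich translate of a k-dimensional A and
  applying the Schwartz-Zippel lemma with multiplicities shows that its leading form vanishes to
  order l on A, as long as d <= (m - l) gamma q. Forms have coefficients in F_q, but points are taken
  over F_q[t]: the vectors of polynomials of degree < k form a grid of q^k values per coordinate,
  each of them lies in A tensor F_q[t] for some k-dimensional A, and hence a form of degree < l q^k
  vanishing to order l on all A is zero. For a beta-fraction of the A, submodularity of the
  codimension (Shearer's inequality), averaged over GL_n(F_q), shows that the forms vanishing on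
  them have codimension at least beta times the full dimension. Summing over degrees,
  |K| C(m+n-1, n) >= beta C(d+n-1, n); take d = l q^k, m minimal, and let l tend to infinity.

  All dimensions are counted as logarithms of cardinalities.
*)
theory Submission
  imports Defs "HOL-Library.Function_Algebras" "HOL-Library.Infinite_Typeclass" "HOL-Library.Multiset"
    "HOL-Computational_Algebra.Polynomial" "HOL-Real_Asymp.Real_Asymp"
begin

section \<open>Polynomial functions and orders of vanishing\<close>

text \<open>A nonzero polynomial over F_q may be the zero function. Over the infinite domain F_q[t],
  functions represent polynomials faithfully and orders of vanishing can be read off on lines, while
  coefficients in F_q keep each space of polynomials finite, hence countable. Leading forms enter
  because the translate a + A depends on A in an unknown way: the top-degree part does not see the
  shift a. Asking for order l on A, and not just for zeros, admits degrees up to l q^k, and growing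
  l makes all rounding negligible: both binomials behave like powers, so only (d/m)^n survives. The
  constant comes from d = l q^k and (m - l) gamma q = d, which give d/m = q^k / (1 + q^(k-1)/gamma)
  = gamma q / (1 + gamma/q^(k-1)).\<close>

instance poly :: (idom) infinite
proof
  have "inj (\<lambda>n. monom (1::'a) n)"
    by (auto simp: inj_def monom_eq_iff')
  then show "infinite (UNIV :: 'a poly set)"
    using finite_imageD finite_subset infinite_UNIV_nat by (metis top_greatest)
qed

lemma poly_fun_eqI:
  fixes p q :: "'r::{idom,infinite} poly"
  assumes "\<And>c. poly p c = poly q c"
  shows "p = q"
proof (rule ccontr)
  assume "p \<noteq> q"
  then have "finite {x. poly (p - q) x = 0}" by (intro poly_roots_finite) auto
  moreover have "{x. poly (p - q) x = 0} = UNIV" using assms by auto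
  ultimately show False using infinite_UNIV by auto
qed

lemma power_sum_zero_imp_coeffs_zero:
  fixes a :: "nat \<Rightarrow> 'r::{idom,infinite}"
  assumes "\<And>v. (\<Sum>i\<le>d. v ^ i * a i) = 0" and "i \<le> d"
  shows "a i = 0"
proof -
  have "(\<Sum>i\<le>d. monom (a i) i) = 0"
    by (rule poly_fun_eqI) (use assms(1) in \<open>simp add: poly_sum poly_monom mult.commute\<close>)
  then have "coeff (\<Sum>i\<le>d. monom (a i) i) i = 0" by simp
  then show ?thesis using assms(2) by (simp add: coeff_sum)
qed

text \<open>Polynomial functions with coefficients in \<open>C\<close> in the variables \<open>I\<close>: homogeneous of degree
  \<open>d\<close> if \<open>hom\<close>, of degree at most \<open>d\<close> otherwise.\<close>
inductive poly_fun :: "bool \<Rightarrow> 'r::comm_ring_1 set \<Rightarrow> 'i set \<Rightarrow> nat \<Rightarrow> (('i \<Rightarrow> 'r) \<Rightarrow> 'r) \<Rightarrow> bool"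
  for hom C I where
  const: "c \<in> C \<Longrightarrow> (hom \<Longrightarrow> d = 0 \<or> c = 0) \<Longrightarrow> poly_fun hom C I d (\<lambda>_. c)"
| add: "poly_fun hom C I d f \<Longrightarrow> poly_fun hom C I d g \<Longrightarrow> poly_fun hom C I d (\<lambda>x. f x + g x)"
| var: "i \<in> I \<Longrightarrow> poly_fun hom C I d f \<Longrightarrow> poly_fun hom C I (Suc d) (\<lambda>x. x i * f x)"

lemma poly_fun_sum:
  assumes "0 \<in> C" and "\<And>a. a \<in> A \<Longrightarrow> poly_fun hom C I d (f a)"
  shows "poly_fun hom C I d (\<lambda>x. \<Sum>a\<in>A. f a x)"
  using assms(2)
  by (induction A rule: infinite_finite_induct) (auto intro: poly_fun.intros assms(1))

lemma poly_fun_Suc: "poly_fun False C I d f \<Longrightarrow> poly_fun False C I (Suc d) f"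
  by (induction rule: poly_fun.induct) (auto intro: poly_fun.intros)

lemma poly_fun_mono: "poly_fun False C I d f \<Longrightarrow> d \<le> e \<Longrightarrow> poly_fun False C I e f"
  by (induction e) (auto simp: le_Suc_eq intro: poly_fun_Suc)

lemma poly_fun_weaken: "poly_fun hom C I d f \<Longrightarrow> C \<subseteq> C' \<Longrightarrow> poly_fun hom C' I d f"
  by (induction rule: poly_fun.induct) (auto intro: poly_fun.intros)

lemma poly_fun_inhomogeneous: "poly_fun hom C I d f \<Longrightarrow> poly_fun False C I d f"
  by (induction rule: poly_fun.induct) (auto intro: poly_fun.intros)

lemma poly_fun_cmult:
  assumes "\<And>a b. a \<in> C \<Longrightarrow> b \<in> C \<Longrightarrow> a * b \<in> C" and "c \<in> C"
    and "poly_fun hom C I d f"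
  shows "poly_fun hom C I d (\<lambda>x. c * f x)"
  using assms(3)
proof (induction rule: poly_fun.induct)
  case (const c' d)
  then show ?case using assms(1)[OF assms(2) const(1)] by (intro poly_fun.const) auto
next
  case (var i d f)
  from poly_fun.var[OF this(1) this(3)] show ?case by (simp add: mult.left_commute)
qed (auto intro: poly_fun.intros simp: distrib_left)

lemma poly_fun_mult:
  assumes "\<And>a b. a \<in> C \<Longrightarrow> b \<in> C \<Longrightarrow> a * b \<in> C"
    and "poly_fun hom C I d f" and g: "poly_fun hom C I e g"
  shows "poly_fun hom C I (d + e) (\<lambda>x. f x * g x)"
  using assms(2)
proof (induction rule: poly_fun.induct)
  case (const c d)
  show ?case
  proof (cases hom)
    case True
    then have "d = 0 \<or> c = 0" using const by auto
    then show ?thesis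
      using poly_fun_cmult[OF assms(1) const(1) g] const(1) by (auto intro: poly_fun.const)
  next
    case False
    then show ?thesis
      using poly_fun_mono[of C I e _ "d + e"] poly_fun_cmult[OF assms(1) const(1) g] by auto
  qed
next
  case (var i d f)
  from poly_fun.var[OF this(1) this(3)] show ?case by (simp add: mult.assoc)
qed (auto intro: poly_fun.intros assms simp: distrib_right)

lemma poly_fun_comp:
  assumes "\<And>a b. a \<in> C \<Longrightarrow> b \<in> C \<Longrightarrow> a * b \<in> C"
    and "poly_fun hom C I d f" and L: "\<And>i. i \<in> I \<Longrightarrow> poly_fun hom C J 1 (L i)"
  shows "poly_fun hom C J d (\<lambda>x. f (\<lambda>i. L i x))"
  using assms(2)
proof (induction rule: poly_fun.induct)
  case (var i d f)
  from poly_fun_mult[OF assms(1) L[OF this(1)] this(3)] show ?case by simp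
qed (auto intro: poly_fun.intros)

lemma poly_fun_cong:
  "poly_fun hom C I d f \<Longrightarrow> (\<And>i. i \<in> I \<Longrightarrow> x i = y i) \<Longrightarrow> f x = f y"
  by (induction rule: poly_fun.induct) auto

lemma poly_fun_line:
  assumes "poly_fun hom C I d f"
  shows "\<exists>p. \<forall>c. f (\<lambda>i. x i + c * u i) = poly p c"
  using assms
proof (induction rule: poly_fun.induct)
  case (const c d)
  then show ?case by (intro exI[of _ "[:c:]"]) simp
next
  case (add d f g)
  then obtain p q where "\<forall>c. f (\<lambda>i. x i + c * u i) = poly p c" "\<forall>c. g (\<lambda>i. x i + c * u i) = poly q c"
    by blast
  then show ?case by (intro exI[of _ "p + q"]) simp
next
  case (var i d f)
  then obtain p where "\<forall>c. f (\<lambda>i. x i + c * u i) = poly p c" by blast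
  then show ?case by (intro exI[of _ "[:x i, u i:] * p"]) (simp add: algebra_simps)
qed

text \<open>The drop from \<open>d\<close> to \<open>d - i\<close> in the degree bound is what pays
  for the power of \<open>x j\<close> in the Schwartz-Zippel induction.\<close>

lemma poly_fun_split:
  assumes "poly_fun False UNIV (insert j I) d f"
  shows "\<exists>g. (\<forall>i\<le>d. poly_fun False UNIV I (d - i) (g i)) \<and> (\<forall>x. f x = (\<Sum>i\<le>d. x j ^ i * g i x))"
  using assms
proof (induction rule: poly_fun.induct)
  case (const c d)
  show ?case
  proof (intro exI[of _ "\<lambda>i _. if i = 0 then c else 0"] conjI allI impI)
    show "c = (\<Sum>i\<le>d. x j ^ i * (if i = 0 then c else 0))" for x :: "'b \<Rightarrow> 'a"
      by (simp add: if_distrib if_distribR cong: if_cong)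
  qed (auto intro: poly_fun.const)
next
  case (add d f f')
  then obtain g g' where
    "\<forall>i\<le>d. poly_fun False UNIV I (d - i) (g i)" "\<forall>x. f x = (\<Sum>i\<le>d. x j ^ i * g i x)"
    "\<forall>i\<le>d. poly_fun False UNIV I (d - i) (g' i)" "\<forall>x. f' x = (\<Sum>i\<le>d. x j ^ i * g' i x)"
    by blast
  then show ?case
    by (intro exI[of _ "\<lambda>i x. g i x + g' i x"])
       (auto intro: poly_fun.add simp: sum.distrib distrib_left)
next
  case (var i d f)
  then obtain g where g:
    "\<forall>i\<le>d. poly_fun False UNIV I (d - i) (g i)" "\<forall>x. f x = (\<Sum>i\<le>d. x j ^ i * g i x)"
    by blast
  show ?case
  proof (cases "i = j")
    case True
    show ?thesis
    proof (intro exI[of _ "\<lambda>k. case k of 0 \<Rightarrow> (\<lambda>_. 0) | Suc k \<Rightarrow> g k"] conjI allI impI)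
      fix k assume "k \<le> Suc d"
      then show "poly_fun False UNIV I (Suc d - k) (case k of 0 \<Rightarrow> (\<lambda>_. 0) | Suc k \<Rightarrow> g k)"
        using g by (cases k) (auto intro: poly_fun.const)
    next
      fix x :: "'b \<Rightarrow> 'a"
      show "x i * f x = (\<Sum>k\<le>Suc d. x j ^ k * (case k of 0 \<Rightarrow> (\<lambda>_. 0) | Suc k \<Rightarrow> g k) x)"
        by (subst sum.atMost_Suc_shift) (simp add: g True sum_distrib_left mult.assoc)
    qed
  next
    case False
    show ?thesis
    proof (intro exI[of _ "\<lambda>k x. if k \<le> d then x i * g k x else 0"] conjI allI impI)
      fix k assume "k \<le> Suc d"
      then show "poly_fun False UNIV I (Suc d - k) (\<lambda>x. if k \<le> d then x i * g k x else 0)"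
        using g False var(1) by (cases "k \<le> d") (auto intro: poly_fun.intros simp: Suc_diff_le)
    next
      fix x :: "'b \<Rightarrow> 'a"
      have "x i * f x = (\<Sum>k\<le>d. x j ^ k * (x i * g k x))"
        by (simp add: g sum_distrib_left mult.left_commute)
      then show "x i * f x = (\<Sum>k\<le>Suc d. x j ^ k * (if k \<le> d then x i * g k x else 0))"
        by simp
    qed
  qed
qed

text \<open>The lowest-order part of \<open>f\<close> at \<open>x\<close> is tested on lines; over an infinite domain this is
  equivalent to the vanishing of all Hasse derivatives of order below \<open>m\<close>.\<close>
definition vanishes_to_order :: "nat \<Rightarrow> (('i \<Rightarrow> 'r::comm_ring_1) \<Rightarrow> 'r) \<Rightarrow> ('i \<Rightarrow> 'r) \<Rightarrow> bool" where
  "vanishes_to_order m f x \<longleftrightarrow>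
     (\<forall>u p. (\<forall>c. f (\<lambda>i. x i + c * u i) = poly p c) \<longrightarrow> (\<forall>j<m. coeff p j = 0))"

lemma vanishes_to_orderD:
  "vanishes_to_order m f x \<Longrightarrow> (\<And>c. f (\<lambda>i. x i + c * u i) = poly p c) \<Longrightarrow> j < m \<Longrightarrow> coeff p j = 0"
  unfolding vanishes_to_order_def by blast

text \<open>Over an infinite domain the restriction to a line determines its polynomial, so one
  witness per direction suffices although the definition quantifies over all
  \<open>p\<close>.\<close>

lemma vanishes_to_orderI:
  fixes f :: "('i \<Rightarrow> 'r::{idom,infinite}) \<Rightarrow> 'r"
  assumes "\<And>u. \<exists>p. (\<forall>c. f (\<lambda>i. x i + c * u i) = poly p c) \<and> (\<forall>j<m. coeff p j = 0)"
  shows "vanishes_to_order m f x"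
  unfolding vanishes_to_order_def
proof (intro allI impI)
  fix u p j assume p: "\<forall>c. f (\<lambda>i. x i + c * u i) = poly p c" and j: "j < m"
  obtain p' where p': "\<forall>c. f (\<lambda>i. x i + c * u i) = poly p' c" "\<forall>j<m. coeff p' j = 0"
    using assms by blast
  have "p = p'" using p p' by (intro poly_fun_eqI) metis
  then show "coeff p j = 0" using p' j by simp
qed

lemma vanishes_to_order_diff:
  fixes f :: "('i \<Rightarrow> 'r::{idom,infinite}) \<Rightarrow> 'r"
  assumes "poly_fun hom C I d f" "poly_fun hom' C' I' d' g"
    and "vanishes_to_order m f x" "vanishes_to_order m g x"
  shows "vanishes_to_order m (f - g) x"
proof (rule vanishes_to_orderI)
  fix u
  obtain p q where "\<forall>c. f (\<lambda>i. x i + c * u i) = poly p c" "\<forall>c. g (\<lambda>i. x i + c * u i) = poly q c"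
    using poly_fun_line[OF assms(1)] poly_fun_line[OF assms(2)] by metis
  then show "\<exists>p. (\<forall>c. (f - g) (\<lambda>i. x i + c * u i) = poly p c) \<and> (\<forall>j<m. coeff p j = 0)"
    using vanishes_to_orderD[OF assms(3), of u p] vanishes_to_orderD[OF assms(4), of u q]
    by (intro exI[of _ "p - q"]) auto
qed

text \<open>Affine substitutions map lines to lines, so each restriction of the composition is a
  restriction of \<open>f\<close> to a line through the image point.\<close>

lemma vanishes_to_order_affine:
  assumes "vanishes_to_order m f (\<lambda>i. a i + (\<Sum>j\<in>J. z j * b j i))"
  shows "vanishes_to_order m (\<lambda>z. f (\<lambda>i. a i + (\<Sum>j\<in>J. z j * b j i))) z"
  unfolding vanishes_to_order_def
proof (intro allI impI)
  fix u p k assume p: "\<forall>c. f (\<lambda>i. a i + (\<Sum>j\<in>J. (z j + c * u j) * b j i)) = poly p c" and k: "k < m"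
  have "f (\<lambda>i. (a i + (\<Sum>j\<in>J. z j * b j i)) + c * (\<Sum>j\<in>J. u j * b j i)) = poly p c" for c
    using p[rule_format, of c]
    by (simp add: distrib_right sum.distrib sum_distrib_left mult.assoc add.assoc)
  from vanishes_to_orderD[OF assms this k] show "coeff p k = 0" .
qed

text \<open>Expanding \<open>f\<close> around \<open>x(j := y)\<close> along the directions \<open>u(j := v)\<close> gives a polynomial in
  \<open>v\<close> for each order; its coefficients are the sums below.\<close>
lemma vanishes_to_order_split:
  fixes f :: "('i \<Rightarrow> 'r::{idom,infinite}) \<Rightarrow> 'r"
  assumes f: "\<And>x. f x = (\<Sum>i\<le>d. x j ^ i * g i x)"
    and g: "\<And>i. i \<le> d \<Longrightarrow> poly_fun False UNIV I (e i) (g i)" and j: "j \<notin> I"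
    and van: "vanishes_to_order m f (x(j := y))"
    and p: "\<And>i c. i \<le> d \<Longrightarrow> g i (\<lambda>i. x i + c * u i) = poly (p i) c"
    and km: "k + l < m"
  shows "(\<Sum>i\<le>d. of_nat (i choose k) * y ^ (i - k) * coeff (p i) l) = 0"
proof -
  define a' where "a' t = (\<Sum>i\<le>d. of_nat (i choose t) * y ^ (i - t) * coeff (p i) (k + l - t))" for t
  have lin: "coeff ([:y, v:] ^ i) t = of_nat (i choose t) * v ^ t * y ^ (i - t)" for i t v
  proof (cases "t \<le> i")
    case True then show ?thesis by (rule coeff_linear_poly_power)
  next
    case False
    have "degree ([:y, v:] ^ i) \<le> i * 1"
      by (rule le_trans[OF degree_power_le]) (simp add: mult.commute)
    then show ?thesis using False by (simp add: coeff_eq_0 binomial_eq_0)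
  qed
  have "(\<Sum>t\<le>k + l. v ^ t * a' t) = 0" for v
  proof -
    have "coeff (\<Sum>i\<le>d. [:y, v:] ^ i * p i) (k + l) = 0"
    proof (rule vanishes_to_orderD[OF van _ km, where u = "u(j := v)"])
      fix c
      \<comment> \<open>As \<open>j \<notin> I\<close>, changing coordinate \<open>j\<close> does
        not affect \<open>g i\<close>; only the powers of that coordinate see \<open>y\<close> and
        \<open>v\<close>.\<close>
      have "g i (\<lambda>i. (x(j := y)) i + c * (u(j := v)) i) = poly (p i) c" if "i \<le> d" for i
        using p[OF that, of c] j by (subst poly_fun_cong[OF g[OF that], where y = "\<lambda>i. x i + c * u i"]) auto
      then show "f (\<lambda>i. (x(j := y)) i + c * (u(j := v)) i) = poly (\<Sum>i\<le>d. [:y, v:] ^ i * p i) c"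
        by (simp add: f poly_sum)
    qed
    also have "coeff (\<Sum>i\<le>d. [:y, v:] ^ i * p i) (k + l) =
        (\<Sum>i\<le>d. \<Sum>t\<le>k + l. of_nat (i choose t) * v ^ t * y ^ (i - t) * coeff (p i) (k + l - t))"
      by (simp add: coeff_sum coeff_mult lin)
    also have "\<dots> = (\<Sum>t\<le>k + l. v ^ t * a' t)"
      by (subst sum.swap) (simp add: a'_def sum_distrib_left mult_ac)
    finally show ?thesis .
  qed
  from power_sum_zero_imp_coeffs_zero[OF this, of k] show ?thesis by (simp add: a'_def)
qed

section \<open>The Schwartz--Zippel lemma with multiplicities\<close>

lemma pcompose_power: "pcompose (p ^ n) q = pcompose p q ^ n" for p q :: "'r::comm_ring_1 poly"
  by (induction n) (simp_all add: pcompose_mult pcompose_1)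

lemma pcompose_monom: "pcompose (monom c n) q = smult c (q ^ n)" for q :: "'r::comm_ring_1 poly"
  by (simp add: monom_altdef pcompose_smult pcompose_power pcompose_pCons)

text \<open>Shifting back by \<open>y\<close> turns the vanishing coefficients into divisibility by
  \<open>[:-y, 1:] ^ w y\<close>, and the orders of the roots add up to at most the degree.\<close>

lemma sum_multiplicities_le_degree:
  fixes p :: "'r::idom poly"
  assumes "p \<noteq> 0" "finite S"
    and van: "\<And>y k. y \<in> S \<Longrightarrow> k < w y \<Longrightarrow> coeff (pcompose p [:y, 1:]) k = 0"
  shows "(\<Sum>y\<in>S. w y) \<le> degree p"
proof -
  have ord: "w y \<le> order y p" if "y \<in> S" for y
  proof -
    have "monom 1 (w y) dvd pcompose p [:y, 1:]" using van[OF that] by (simp add: monom_1_dvd_iff')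
    then obtain r where "pcompose p [:y, 1:] = monom 1 (w y) * r" by (auto elim: dvdE)
    then have "pcompose (pcompose p [:y, 1:]) [:-y, 1:] = [:-y, 1:] ^ w y * pcompose r [:-y, 1:]"
      by (simp add: pcompose_mult pcompose_monom)
    moreover have "pcompose (pcompose p [:y, 1:]) [:-y, 1:] = p"
      by (simp add: pcompose_assoc[symmetric] pcompose_pCons)
    ultimately have "[:-y, 1:] ^ w y dvd p" by (metis dvd_triv_left)
    then show ?thesis using \<open>p \<noteq> 0\<close> by (simp add: order_divides)
  qed
  have "(\<Sum>y\<in>S. w y) = (\<Sum>y\<in>{y\<in>S. poly p y = 0}. w y)"
  proof (rule sum.mono_neutral_right)
    show "\<forall>i\<in>S - {y \<in> S. poly p y = 0}. w i = 0"
      using ord \<open>p \<noteq> 0\<close> by (fastforce simp: order_root)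
  qed (use assms(2) in auto)
  also have "\<dots> \<le> (\<Sum>y\<in>{y\<in>S. poly p y = 0}. order y p)" by (rule sum_mono) (use ord in auto)
  also have "\<dots> \<le> (\<Sum>y | poly p y = 0. order y p)"
    by (rule sum_mono2) (auto intro: poly_roots_finite[OF \<open>p \<noteq> 0\<close>])
  also have "\<dots> \<le> degree p" by (rule sum_order_le_degree[OF \<open>p \<noteq> 0\<close>])
  finally show ?thesis .
qed

lemma coeff_pcompose_linear:
  fixes a :: "nat \<Rightarrow> 'r::idom"
  shows "coeff (pcompose (\<Sum>i\<le>r. monom (a i) i) [:y, 1:]) k = (\<Sum>i\<le>r. of_nat (i choose k) * y ^ (i - k) * a i)"
proof -
  have "coeff ([:y, 1:] ^ i) k = of_nat (i choose k) * y ^ (i - k)" for i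
  proof (cases "k \<le> i")
    case True then show ?thesis by (simp add: coeff_linear_poly_power)
  next
    case False
    have "degree ([:y, 1:] ^ i) \<le> i" by (rule le_trans[OF degree_power_le]) simp
    then show ?thesis using False by (simp add: coeff_eq_0 binomial_eq_0)
  qed
  then show ?thesis by (simp add: pcompose_sum pcompose_monom coeff_sum mult.commute)
qed

text \<open>The line from \<open>x\<close> through \<open>x0\<close> restricts \<open>f\<close> to a
  nonzero polynomial, any nonzero coefficient of which bounds the order at \<open>x\<close>.\<close>

lemma maximal_vanishing_order:
  fixes f :: "('i \<Rightarrow> 'r::{idom,infinite}) \<Rightarrow> 'r"
  assumes "poly_fun hom C I d f" "f x0 \<noteq> 0"
  shows "\<exists>n. vanishes_to_order n f x \<and> \<not> vanishes_to_order (Suc n) f x"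
proof -
  obtain p where p: "\<And>c. f (\<lambda>i. x i + c * (x0 i - x i)) = poly p c"
    using poly_fun_line[OF assms(1), where x = x and u = "\<lambda>i. x0 i - x i"] by auto
  have "p \<noteq> 0" using p[of 1] assms(2) by auto
  then obtain k where "coeff p k \<noteq> 0" by (metis leading_coeff_0_iff)
  then have "\<not> vanishes_to_order (Suc k) f x" using vanishes_to_orderD[OF _ p] by blast
  moreover have "vanishes_to_order 0 f x" by (simp add: vanishes_to_order_def)
  ultimately show ?thesis
    using ex_least_nat_less[of "\<lambda>n. \<not> vanishes_to_order n f x" "Suc k"] by blast
qed

text \<open>The induction isolates one variable \<open>j\<close>. If \<open>g r\<close> is the leading coefficient of \<open>f\<close> in
  that variable and vanishes exactly to order \<open>n\<close> at \<open>x\<close>, then the \<open>n\<close>-th order part of \<open>f\<close> along a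
  suitable direction is a univariate polynomial in the variable \<open>j\<close> of degree exactly \<open>r\<close>, which
  loses at most \<open>n\<close> from the multiplicities of \<open>f\<close> on the line above \<open>x\<close>.\<close>
theorem schwartz_zippel_multiplicity:
  fixes f :: "('i \<Rightarrow> 'r::{idom,infinite}) \<Rightarrow> 'r"
  assumes "finite I" "finite S"
    and "poly_fun False UNIV I d f" "f x0 \<noteq> 0"
    and "\<And>x. x \<in> I \<rightarrow>\<^sub>E S \<Longrightarrow> vanishes_to_order (\<mu> x) f x"
  shows "card S * (\<Sum>x\<in>I \<rightarrow>\<^sub>E S. \<mu> x) \<le> d * card S ^ card I"
  using assms(1,3-5)
proof (induction I arbitrary: d f x0 \<mu> rule: finite_induct)
  case empty
  have "\<mu> (\<lambda>_. undefined) = 0"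
  proof (rule ccontr)
    assume "\<mu> (\<lambda>_. undefined) \<noteq> 0"
    moreover have "f (\<lambda>i. undefined + c * 0) = poly [:f x0:] c" for c
      using poly_fun_cong[OF empty(1)] by auto
    ultimately have "coeff [:f x0:] 0 = 0"
      by (intro vanishes_to_orderD[OF empty(3), of "\<lambda>_. undefined" "\<lambda>_. 0"]) auto
    then show False using empty(2) by simp
  qed
  then show ?case by simp
next
  case (insert j I)
  obtain g where g: "\<And>i. i \<le> d \<Longrightarrow> poly_fun False UNIV I (d - i) (g i)"
    and f: "\<And>x. f x = (\<Sum>i\<le>d. x j ^ i * g i x)"
    using poly_fun_split[OF insert.prems(1)] by blast
  \<comment> \<open>The degree of \<open>f\<close> in the variable \<open>j\<close>. Its coefficient
    \<open>g r\<close> has degree at most \<open>d - r\<close>, which leaves room for the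
    \<open>r\<close> lost on each line.\<close>
  define r where "r = Max {i. i \<le> d \<and> (\<exists>x. g i x \<noteq> 0)}"
  have "{i. i \<le> d \<and> (\<exists>x. g i x \<noteq> 0)} \<noteq> {}" (is "?D \<noteq> {}")
  proof
    assume "?D = {}"
    then have "f x0 = 0" by (auto simp: f intro!: sum.neutral)
    then show False using insert.prems(2) by simp
  qed
  then have "r \<in> ?D" unfolding r_def by (intro Max_in) auto
  then obtain x1 where r: "r \<le> d" "g r x1 \<noteq> 0" by blast
  have above: "g i x = 0" if "r < i" "i \<le> d" for i x
    using Max_ge[of ?D i] that unfolding r_def by (fastforce simp: not_less)
  obtain n where n: "\<And>x. vanishes_to_order (n x) (g r) x" "\<And>x. \<not> vanishes_to_order (Suc (n x)) (g r) x"
    using maximal_vanishing_order[OF g[OF r(1)] r(2)] by metis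
  have IH: "card S * (\<Sum>x\<in>I \<rightarrow>\<^sub>E S. n x) \<le> (d - r) * card S ^ card I"
    by (rule insert.IH[OF g[OF r(1)] r(2)]) (rule n)
  have line: "(\<Sum>y\<in>S. \<mu> (x(j := y))) \<le> card S * n x + r" if x: "x \<in> I \<rightarrow>\<^sub>E S" for x
  proof -
    obtain u q l where q: "\<And>c. g r (\<lambda>i. x i + c * u i) = poly q c" and l: "l < Suc (n x)" "coeff q l \<noteq> 0"
      using n(2)[of x] unfolding vanishes_to_order_def by blast
    have ln: "l = n x" using vanishes_to_orderD[OF n(1) q, of l] l by force
    have "\<exists>p. \<forall>c. g i (\<lambda>i. x i + c * u i) = poly p c" if "i \<le> d" for i
      using poly_fun_line[OF g[OF that]] by blast
    then obtain p where p: "\<And>i c. i \<le> d \<Longrightarrow> g i (\<lambda>i. x i + c * u i) = poly (p i) c" by metis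
    have "p r = q" by (rule poly_fun_eqI) (use p[OF r(1)] q in metis)
    have pz: "p i = 0" if "r < i" "i \<le> d" for i
      by (rule poly_fun_eqI) (use p[OF that(2)] above[OF that] in simp)
    \<comment> \<open>The coefficient of order \<open>l = n x\<close> in direction \<open>u\<close>,
      as a polynomial in the variable \<open>j\<close>; its coefficient at \<open>r\<close> is
      \<open>coeff q l\<close>, hence nonzero.\<close>
    define G where "G = (\<Sum>i\<le>d. monom (coeff (p i) l) i)"
    have cG: "coeff G i = (if i \<le> d then coeff (p i) l else 0)" for i
      by (auto simp: G_def coeff_sum)
    have "G \<noteq> 0" using cG[of r] r(1) l(2) \<open>p r = q\<close> by auto
    have "degree G \<le> r" by (rule degree_le) (auto simp: cG pz)
    \<comment> \<open>The subtraction is truncated: points whose multiplicity is at most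
      \<open>n x\<close> contribute 0.\<close>
    have "(\<Sum>y\<in>S. \<mu> (x(j := y)) - n x) \<le> degree G"
    proof (rule sum_multiplicities_le_degree[OF \<open>G \<noteq> 0\<close> assms(2)])
      fix y k assume y: "y \<in> S" and k: "k < \<mu> (x(j := y)) - n x"
      have "x(j := y) \<in> insert j I \<rightarrow>\<^sub>E S" using x y by (auto simp: PiE_iff extensional_def)
      then have van: "vanishes_to_order (\<mu> (x(j := y))) f (x(j := y))" by (rule insert.prems(3))
      have "k + l < \<mu> (x(j := y))" using k ln by simp
      from vanishes_to_order_split[OF f g insert.hyps(2) van p this]
      show "coeff (pcompose G [:y, 1:]) k = 0" by (simp add: G_def coeff_pcompose_linear)
    qed
    then have "(\<Sum>y\<in>S. \<mu> (x(j := y)) - n x) \<le> r" using \<open>degree G \<le> r\<close> by simp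
    moreover have "(\<Sum>y\<in>S. \<mu> (x(j := y))) \<le> (\<Sum>y\<in>S. (\<mu> (x(j := y)) - n x) + n x)"
      by (rule sum_mono) simp
    ultimately show ?thesis by (simp add: sum.distrib)
  qed
  have "(\<Sum>x\<in>insert j I \<rightarrow>\<^sub>E S. \<mu> x) = (\<Sum>(y, x)\<in>S \<times> (I \<rightarrow>\<^sub>E S). \<mu> (x(j := y)))"
    unfolding PiE_insert_eq
    by (subst sum.reindex[OF inj_combinator[OF insert.hyps(2)]]) (simp add: case_prod_unfold)
  also have "\<dots> = (\<Sum>x\<in>I \<rightarrow>\<^sub>E S. \<Sum>y\<in>S. \<mu> (x(j := y)))"
    by (simp add: sum.cartesian_product[symmetric] sum.swap[of _ S])
  also have "\<dots> \<le> (\<Sum>x\<in>I \<rightarrow>\<^sub>E S. card S * n x + r)" by (rule sum_mono) (rule line)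
  also have "\<dots> = card S * (\<Sum>x\<in>I \<rightarrow>\<^sub>E S. n x) + r * card S ^ card I"
    using insert.hyps(1) by (simp add: sum.distrib sum_distrib_left card_funcsetE)
  also have "\<dots> \<le> (d - r) * card S ^ card I + r * card S ^ card I" using IH by simp
  also have "\<dots> = d * card S ^ card I" using r(1) by (simp add: add_mult_distrib[symmetric])
  finally have "card S * (\<Sum>x\<in>insert j I \<rightarrow>\<^sub>E S. \<mu> x) \<le> card S * (d * card S ^ card I)"
    by (rule mult_le_mono2)
  then show ?case using insert.hyps by (simp add: mult.left_commute)
qed

section \<open>Leading forms on rich translates\<close>

text \<open>At \<open>y = 0\<close> only the term \<open>t = i\<close> of the expansion survives, so
  passing to the coefficient of \<open>x j ^ i\<close> costs just \<open>i\<close> in the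
  order.\<close>

lemma vanishes_to_order_coefficient:
  fixes f :: "('i \<Rightarrow> 'r::{idom,infinite}) \<Rightarrow> 'r"
  assumes f: "\<And>x. f x = (\<Sum>i\<le>d. x j ^ i * g i x)"
    and g: "\<And>i. i \<le> d \<Longrightarrow> poly_fun False UNIV I (e i) (g i)" and j: "j \<notin> I"
    and van: "vanishes_to_order m f (x(j := 0))" and i: "i \<le> d"
  shows "vanishes_to_order (m - i) (g i) x"
  unfolding vanishes_to_order_def
proof (intro allI impI)
  fix u q l assume q: "\<forall>c. g i (\<lambda>i. x i + c * u i) = poly q c" and l: "l < m - i"
  have "\<exists>p. \<forall>c. g i (\<lambda>i. x i + c * u i) = poly p c" if "i \<le> d" for i
    using poly_fun_line[OF g[OF that]] by blast
  then obtain p where p: "\<And>i c. i \<le> d \<Longrightarrow> g i (\<lambda>i. x i + c * u i) = poly (p i) c" by metis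
  have "p i = q" by (rule poly_fun_eqI) (use p[OF i] q in metis)
  have "i + l < m" using l by simp
  from vanishes_to_order_split[OF f g j van p this]
  have "0 = (\<Sum>t\<le>d. of_nat (t choose i) * 0 ^ (t - i) * coeff (p t) l)" by simp
  also have "\<dots> = (\<Sum>t\<le>d. if t = i then coeff (p t) l else 0)"
    by (intro sum.cong refl) (auto simp: binomial_eq_0 power_0_left)
  finally show "coeff q l = 0" using i \<open>p i = q\<close> by simp
qed

text \<open>Scaling by \<open>t\<close> isolates the leading form: for homogeneous \<open>f\<close>
  the shift \<open>a\<close> affects only powers below \<open>t ^ d\<close>.\<close>

lemma poly_fun_expand:
  assumes "poly_fun hom UNIV I d f"
  shows "\<exists>r. \<forall>t s. f (\<lambda>i. a i + t * (w i + s * y i)) = (\<Sum>i\<le>d. t ^ i * poly (r i) s)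
           \<and> (hom \<longrightarrow> poly (r d) s = f (\<lambda>i. w i + s * y i))"
  using assms
proof (induction rule: poly_fun.induct)
  case (const c d)
  show ?case
    by (intro exI[of _ "\<lambda>i. if i = 0 then [:c:] else 0"])
       (use const in \<open>auto simp: if_distrib if_distribR cong: if_cong\<close>)
next
  case (add d f g)
  then obtain p q where
    "\<forall>t s. f (\<lambda>i. a i + t * (w i + s * y i)) = (\<Sum>i\<le>d. t ^ i * poly (p i) s)
       \<and> (hom \<longrightarrow> poly (p d) s = f (\<lambda>i. w i + s * y i))"
    "\<forall>t s. g (\<lambda>i. a i + t * (w i + s * y i)) = (\<Sum>i\<le>d. t ^ i * poly (q i) s)
       \<and> (hom \<longrightarrow> poly (q d) s = g (\<lambda>i. w i + s * y i))"
    by blast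
  then show ?case
    by (intro exI[of _ "\<lambda>i. p i + q i"]) (simp add: distrib_left sum.distrib)
next
  case (var j d f)
  then obtain r where r: "\<And>t s. f (\<lambda>i. a i + t * (w i + s * y i)) = (\<Sum>i\<le>d. t ^ i * poly (r i) s)"
    "\<And>s. hom \<Longrightarrow> poly (r d) s = f (\<lambda>i. w i + s * y i)"
    by blast
  define r' where "r' i = [:a j:] * (if i \<le> d then r i else 0) +
      [:w j, y j:] * (case i of 0 \<Rightarrow> 0 | Suc i \<Rightarrow> r i)" for i
  have "(a j + t * (w j + s * y j)) * (\<Sum>i\<le>d. t ^ i * poly (r i) s) = (\<Sum>i\<le>Suc d. t ^ i * poly (r' i) s)" for t s
  proof -
    have "(\<Sum>i\<le>Suc d. t ^ i * poly (r' i) s) =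
        a j * (\<Sum>i\<le>Suc d. t ^ i * (if i \<le> d then poly (r i) s else 0)) +
        (w j + s * y j) * (\<Sum>i\<le>Suc d. t ^ i * (case i of 0 \<Rightarrow> 0 | Suc i \<Rightarrow> poly (r i) s))"
      unfolding sum_distrib_left sum.distrib[symmetric]
      by (intro sum.cong refl) (auto simp: r'_def algebra_simps split: nat.split)
    also have "(\<Sum>i\<le>Suc d. t ^ i * (if i \<le> d then poly (r i) s else 0)) = (\<Sum>i\<le>d. t ^ i * poly (r i) s)"
      by simp
    also have "(\<Sum>i\<le>Suc d. t ^ i * (case i of 0 \<Rightarrow> 0 | Suc i \<Rightarrow> poly (r i) s)) =
        t * (\<Sum>i\<le>d. t ^ i * poly (r i) s)"
      by (subst sum.atMost_Suc_shift) (simp add: sum_distrib_left mult.assoc)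
    finally show ?thesis by (simp add: algebra_simps)
  qed
  moreover have "poly (r' (Suc d)) s = (w j + s * y j) * f (\<lambda>i. w i + s * y i)" if hom for s
    using r(2)[OF that] by (simp add: r'_def algebra_simps)
  ultimately show ?case by (intro exI[of _ r']) (auto simp: r(1))
qed

text \<open>The degree of \<open>f\<close> is too small to reach \<open>t ^ e\<close>. For
  \<open>e = 0\<close> the truncated \<open>e - 1\<close> would still admit constants, hence the
  separate hypothesis.\<close>

lemma poly_fun_expand_leading:
  assumes "poly_fun True UNIV I e h" "poly_fun False UNIV I (e - 1) f" "e = 0 \<Longrightarrow> f = (\<lambda>_. 0)"
  shows "\<exists>r. (\<forall>t s. h (\<lambda>i. a i + t * (w i + s * y i)) + f (\<lambda>i. a i + t * (w i + s * y i)) =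
            (\<Sum>i\<le>e. t ^ i * poly (r i) s)) \<and> (\<forall>s. poly (r e) s = h (\<lambda>i. w i + s * y i))"
proof -
  obtain p where p: "\<And>t s. h (\<lambda>i. a i + t * (w i + s * y i)) = (\<Sum>i\<le>e. t ^ i * poly (p i) s)"
    "\<And>s. poly (p e) s = h (\<lambda>i. w i + s * y i)"
    using poly_fun_expand[OF assms(1), of a w y] by auto
  show ?thesis
  proof (cases e)
    case 0
    then show ?thesis using p assms(3) by (intro exI[of _ p]) auto
  next
    case (Suc e')
    obtain q where q: "\<And>t s. f (\<lambda>i. a i + t * (w i + s * y i)) = (\<Sum>i\<le>e'. t ^ i * poly (q i) s)"
      using poly_fun_expand[OF assms(2), of a w y] Suc by auto
    show ?thesis
    proof (intro exI[of _ "\<lambda>i. p i + (if i \<le> e' then q i else 0)"] conjI allI)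
      fix t s
      have "(\<Sum>i\<le>e. t ^ i * poly (p i + (if i \<le> e' then q i else 0)) s) =
          (\<Sum>i\<le>e. t ^ i * poly (p i) s) + (\<Sum>i\<le>e. t ^ i * (if i \<le> e' then poly (q i) s else 0))"
        unfolding sum.distrib[symmetric] by (intro sum.cong refl) (simp add: distrib_left)
      also have "(\<Sum>i\<le>e. t ^ i * (if i \<le> e' then poly (q i) s else 0)) = (\<Sum>i\<le>e'. t ^ i * poly (q i) s)"
        by (simp add: Suc)
      finally show "h (\<lambda>i. a i + t * (w i + s * y i)) + f (\<lambda>i. a i + t * (w i + s * y i)) =
          (\<Sum>i\<le>e. t ^ i * poly (p i + (if i \<le> e' then q i else 0)) s)"
        by (simp only: p q)
    qed (simp add: Suc p(2)[unfolded Suc])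
  qed
qed

text \<open>The extension of scalars of \<open>A\<close> from \<open>F\<close> to \<open>F[t]\<close>, inside \<open>F[t] ^ n\<close>.\<close>
definition scalar_ext :: "('a::{field,finite} ^ 'n) set \<Rightarrow> ('n \<Rightarrow> 'a poly) set" where
  "scalar_ext A = {w. \<exists>z. w = (\<lambda>i. \<Sum>v\<in>A. z v * [:v $ i:])}"

lemma subspace_parametrization:
  fixes A :: "('a::{field,finite} ^ 'n) set"
  assumes "A \<in> lin_subspaces k"
  obtains b :: "nat \<Rightarrow> 'a ^ 'n" where "\<And>v. v \<in> A \<Longrightarrow> \<exists>z. v = (\<Sum>j<k. z j *s b j)"
proof -
  have A: "vec.subspace A" "vec.dim A = k" using assms by (auto simp: lin_subspaces_def)
  obtain B where B: "finite B" "vec.span B = A" "card B = k"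
    using vec.basis_subspace_exists[OF A(1)] A(2) by metis
  obtain b where b: "bij_betw b {..<k} B"
    using ex_bij_betw_nat_finite[OF B(1)] B(3) by (auto simp: atLeast0LessThan)
  have "\<exists>z. v = (\<Sum>j<k. z j *s b j)" if "v \<in> A" for v
  proof -
    have "v \<in> range (\<lambda>u. \<Sum>x\<in>B. u x *s x)" using that B vec.span_finite[OF B(1)] by blast
    then obtain u where "v = (\<Sum>x\<in>B. u x *s x)" by blast
    then have "v = (\<Sum>j<k. u (b j) *s b j)" using sum.reindex_bij_betw[OF b, of "\<lambda>x. u x *s x"] by simp
    then show ?thesis by (intro exI[of _ "\<lambda>j. u (b j)"])
  qed
  then show ?thesis by (rule that)
qed

lemma sum_pCons_0: "(\<Sum>i\<in>A. [:f i:]) = [:\<Sum>i\<in>A. f i:]"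
  by (induction A rule: infinite_finite_induct) auto

lemma card_constants: "card (range (\<lambda>c::'a::{field,finite}. [:c:])) = CARD('a)"
  by (simp add: card_image inj_def)

text \<open>Restrict \<open>h + f\<close> to \<open>a + A\<close> thickened in one further direction with coordinate \<open>s\<close>. For
  \<open>i < l\<close> the coefficient of \<open>s ^ i\<close> has degree at most \<open>e\<close> and vanishes to order \<open>m - i\<close> on the
  many points of \<open>K\<close> in \<open>a + A\<close>, so it is zero.\<close>
lemma leading_form_vanishes:
  fixes A K :: "('a::{field,finite} ^ 'n) set" and h f :: "('n \<Rightarrow> 'a poly) \<Rightarrow> 'a poly"
  assumes A: "A \<in> lin_subspaces k" and rich: "rich (\<gamma> * real CARD('a) ^ k) K ((\<lambda>x. a + x) ` A)"
    and h: "poly_fun True UNIV UNIV e h" and f: "poly_fun False UNIV UNIV (e - 1) f" "e = 0 \<Longrightarrow> f = (\<lambda>_. 0)"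
    and van: "\<And>v. v \<in> K \<Longrightarrow> vanishes_to_order m (\<lambda>x. h x + f x) (\<lambda>i. [:v $ i:])"
    and num: "\<And>i. i < l \<Longrightarrow> real e < real (m - i) * \<gamma> * real CARD('a)"
    and w: "w \<in> scalar_ext A"
  shows "vanishes_to_order l h w"
proof (rule vanishes_to_orderI)
  fix u :: "'n \<Rightarrow> 'a poly"
  let ?q = "real CARD('a)" and ?S = "range (\<lambda>c::'a. [:c:])"
  obtain b where b: "\<And>v. v \<in> A \<Longrightarrow> \<exists>z. v = (\<Sum>j<k. z j *s b j)"
    using subspace_parametrization[OF A] by blast
  then obtain \<rho> where \<rho>: "\<And>v. v \<in> A \<Longrightarrow> v = (\<Sum>j<k. \<rho> v j *s b j)" by metis
  obtain z where z: "w = (\<lambda>i. \<Sum>v\<in>A. z v * [:v $ i:])" using w by (auto simp: scalar_ext_def)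
  \<comment> \<open>The coordinates \<open>\<rho> v j\<close> are field elements, so the same
    vectors \<open>b j\<close> parametrize the extension of scalars, with coordinates in
    \<open>F[t]\<close>.\<close>
  define \<zeta> where "\<zeta> j = (\<Sum>v\<in>A. z v * [:\<rho> v j:])" for j
  have w_eq: "w i = (\<Sum>j<k. \<zeta> j * [:b j $ i:])" for i
  proof -
    have "w i = (\<Sum>v\<in>A. z v * [:\<Sum>j<k. \<rho> v j * b j $ i:])"
      unfolding z using \<rho> by (intro sum.cong refl) (metis (no_types, lifting) sum.cong sum_component vector_smult_component)
    also have "\<dots> = (\<Sum>v\<in>A. \<Sum>j<k. z v * [:\<rho> v j:] * [:b j $ i:])"
      by (simp add: sum_pCons_0[symmetric] sum_distrib_left mult_ac)
    also have "\<dots> = (\<Sum>j<k. \<zeta> j * [:b j $ i:])"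
      by (subst sum.swap) (simp only: \<zeta>_def sum_distrib_right)
    finally show ?thesis .
  qed
  \<comment> \<open>Index \<open>k\<close> carries the arbitrary direction \<open>u\<close> along
    which the order of \<open>h\<close> is tested.\<close>
  define b' where "b' j i = (if j < k then [:b j $ i:] else u i)" for j i
  define F where "F x = h x + f x" for x
  define Q where "Q x = F (\<lambda>i. [:a $ i:] + (\<Sum>j\<in>{..<Suc k}. x j * b' j i))" for x
  have F: "poly_fun False UNIV UNIV e F"
  proof -
    have "poly_fun False UNIV UNIV e h" using h by (rule poly_fun_inhomogeneous)
    then show ?thesis unfolding F_def
      by (intro poly_fun.add poly_fun_mono[OF f(1)]) auto
  qed
  have "poly_fun False UNIV (insert k {..<k}) e Q"
    unfolding Q_def
  proof (rule poly_fun_comp[OF _ F])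
    fix i
    have "poly_fun False UNIV (insert k {..<k}) 1 (\<lambda>x. x j * b' j i)" if "j < Suc k" for j
      unfolding One_nat_def using that by (intro poly_fun.var poly_fun.const) auto
    then show "poly_fun False UNIV (insert k {..<k}) 1 (\<lambda>x. [:a $ i:] + (\<Sum>j\<in>{..<Suc k}. x j * b' j i))"
      by (intro poly_fun.add poly_fun.const poly_fun_sum) auto
  qed auto
  from poly_fun_split[OF this]
  obtain g where g: "\<And>i. i \<le> e \<Longrightarrow> poly_fun False UNIV {..<k} (e - i) (g i)"
    and Q: "\<And>x. Q x = (\<Sum>i\<le>e. x k ^ i * g i x)" by blast
  define v where "v x = a + (\<Sum>j<k. coeff (x j) 0 *s b j)" for x :: "nat \<Rightarrow> 'a poly"
  have "g i x0 = 0" if i: "i < l" "i \<le> e" for i x0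
  proof (rule ccontr)
    assume nz: "g i x0 \<noteq> 0"
    define \<mu> where "\<mu> x = (if v x \<in> K then m - i else 0)" for x
    define T where "T = {x \<in> {..<k} \<rightarrow>\<^sub>E ?S. v x \<in> K}"
    have \<mu>: "vanishes_to_order (\<mu> x) (g i) x" if x: "x \<in> {..<k} \<rightarrow>\<^sub>E ?S" for x
    proof (cases "v x \<in> K")
      case True
      have "[:a $ i:] + (\<Sum>j\<in>{..<Suc k}. (x(k := 0)) j * b' j i) = [:v x $ i:]" for i
      proof -
        have "x j * [:b j $ i:] = [:coeff (x j) 0 * b j $ i:]" if "j < k" for j
          using PiE_mem[OF x, of j] that by auto
        then have "(\<Sum>j\<in>{..<Suc k}. (x(k := 0)) j * b' j i) = (\<Sum>j<k. [:coeff (x j) 0 * b j $ i:])"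
          by (simp add: lessThan_Suc b'_def)
        then show ?thesis by (simp add: v_def sum_pCons_0)
      qed
      then have "vanishes_to_order m Q (x(k := 0))"
        unfolding Q_def using van[OF True] by (intro vanishes_to_order_affine) (simp add: F_def)
      from vanishes_to_order_coefficient[OF Q g _ this i(2)] show ?thesis
        using True by (simp add: \<mu>_def)
    qed (simp add: \<mu>_def vanishes_to_order_def)
    have "finite ?S" by simp
    from schwartz_zippel_multiplicity[OF finite_lessThan this g[OF i(2)] nz, of \<mu>]
    have "CARD('a) * (\<Sum>x\<in>{..<k} \<rightarrow>\<^sub>E ?S. \<mu> x) \<le> (e - i) * CARD('a) ^ k"
      using \<mu> by (simp add: card_constants)
    also have "(\<Sum>x\<in>{..<k} \<rightarrow>\<^sub>E ?S. \<mu> x) = card T * (m - i)"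
      unfolding \<mu>_def T_def by (subst sum.inter_filter[symmetric]) (auto intro: finite_PiE)
    finally have "real (CARD('a) * (card T * (m - i))) \<le> real ((e - i) * CARD('a) ^ k)"
      by (subst of_nat_le_iff)
    also have "\<dots> \<le> real e * ?q ^ k" by (simp add: mult_right_mono)
    finally have 1: "?q * (real (card T) * real (m - i)) \<le> real e * ?q ^ k" by simp
    \<comment> \<open>Every point of \<open>K\<close> in the translate has coordinates in the grid
      of constants, so richness bounds \<open>card T\<close> from below.\<close>
    have "(\<lambda>x. a + x) ` A \<inter> K \<subseteq> v ` T"
    proof
      fix y assume y: "y \<in> (\<lambda>x. a + x) ` A \<inter> K"
      then obtain x where x: "x \<in> A" "y = a + x" by auto
      define x' where "x' = (\<lambda>j\<in>{..<k}. [:\<rho> x j:])"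
      have "v x' = y" using x \<rho>[OF x(1)] by (simp add: v_def x'_def)
      moreover have "x' \<in> T" using y \<open>v x' = y\<close> by (auto simp: T_def x'_def)
      ultimately show "y \<in> v ` T" by blast
    qed
    moreover have "finite T"
      by (rule finite_subset[OF _ finite_PiE[of "{..<k}" "\<lambda>_. ?S"]]) (auto simp: T_def)
    ultimately have "card ((\<lambda>x. a + x) ` A \<inter> K) \<le> card T" by (intro surj_card_le)
    then have "\<gamma> * ?q ^ k \<le> real (card T)" using rich by (simp add: rich_def)
    then have "?q * (\<gamma> * ?q ^ k * real (m - i)) \<le> real e * ?q ^ k"
      by (intro order_trans[OF _ 1] mult_left_mono mult_right_mono) auto
    then have "(real (m - i) * \<gamma> * ?q) * ?q ^ k \<le> real e * ?q ^ k" by (simp add: mult_ac)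
    then have "real (m - i) * \<gamma> * ?q \<le> real e" by simp
    then show False using num[OF i(1)] leD by blast
  qed
  note g0 = this
  obtain r where r: "\<And>t s. F (\<lambda>i. [:a $ i:] + t * (w i + s * u i)) = (\<Sum>i\<le>e. t ^ i * poly (r i) s)"
    and re: "\<And>s. poly (r e) s = h (\<lambda>i. w i + s * u i)"
    using poly_fun_expand_leading[OF h f, of "\<lambda>i. [:a $ i:]" w u] unfolding F_def by auto
  \<comment> \<open>For fixed \<open>t\<close>, comparing two expansions in \<open>s\<close> makes
    the coefficient of \<open>s ^ j\<close> a multiple of a value of \<open>g j\<close>, which is
    zero. Letting \<open>t\<close> vary then separates the top coefficient \<open>r e\<close>, where
    \<open>h\<close> sits.\<close>
  have "coeff (r e) j = 0" if j: "j < l" for j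
  proof (rule power_sum_zero_imp_coeffs_zero[where d = e and a = "\<lambda>i. coeff (r i) j" and i = e])
    fix t :: "'a poly"
    have "(\<Sum>i\<le>e. smult (t ^ i) (r i)) = (\<Sum>i\<le>e. monom (t ^ i * g i (\<lambda>j. t * \<zeta> j)) i)"
    proof (rule poly_fun_eqI)
      fix s
      define x where "x = (\<lambda>j. t * \<zeta> j)(k := t * s)"
      have "poly (\<Sum>i\<le>e. smult (t ^ i) (r i)) s = F (\<lambda>i. [:a $ i:] + t * (w i + s * u i))"
        by (simp add: r poly_sum)
      also have "\<dots> = Q x"
        by (simp add: Q_def x_def lessThan_Suc b'_def w_eq algebra_simps sum_distrib_left)
      also have "\<dots> = (\<Sum>i\<le>e. (t * s) ^ i * g i (\<lambda>j. t * \<zeta> j))"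
        unfolding Q by (intro sum.cong refl arg_cong2[where f = "(*)"])
          (auto simp: x_def intro!: poly_fun_cong[OF g])
      finally show "poly (\<Sum>i\<le>e. smult (t ^ i) (r i)) s = poly (\<Sum>i\<le>e. monom (t ^ i * g i (\<lambda>j. t * \<zeta> j)) i) s"
        by (simp add: poly_sum poly_monom power_mult_distrib mult_ac)
    qed
    then have "coeff (\<Sum>i\<le>e. smult (t ^ i) (r i)) j = coeff (\<Sum>i\<le>e. monom (t ^ i * g i (\<lambda>j. t * \<zeta> j)) i) j"
      by simp
    then show "(\<Sum>i\<le>e. t ^ i * coeff (r i) j) = 0"
      using g0[OF j] by (simp add: coeff_sum split: if_splits)
  qed simp
  then show "\<exists>p. (\<forall>c. h (\<lambda>i. w i + c * u i) = poly p c) \<and> (\<forall>j<l. coeff p j = 0)"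
    using re by metis
qed

section \<open>Forms vanishing on all subspaces\<close>

lemma card_polys_of_bounded_degree:
  "finite {p :: 'a::{field,finite} poly. \<forall>j\<ge>k. coeff p j = 0} \<and>
   card {p :: 'a poly. \<forall>j\<ge>k. coeff p j = 0} = CARD('a) ^ k"
proof (induction k)
  case 0
  have "{p :: 'a poly. \<forall>j\<ge>0. coeff p j = 0} = {0}" by (auto simp: poly_eq_iff)
  then show ?case by simp
next
  case (Suc k)
  let ?S = "\<lambda>k. {p :: 'a poly. \<forall>j\<ge>k. coeff p j = 0}"
  have "?S (Suc k) = (\<lambda>(a, p). pCons a p) ` (UNIV \<times> ?S k)"
  proof
    show "?S (Suc k) \<subseteq> (\<lambda>(a, p). pCons a p) ` (UNIV \<times> ?S k)"
    proof
      fix p assume p: "p \<in> ?S (Suc k)"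
      obtain a p' where "p = pCons a p'" by (cases p)
      with p have "p' \<in> ?S k" by auto
      then show "p \<in> (\<lambda>(a, p). pCons a p) ` (UNIV \<times> ?S k)" using \<open>p = pCons a p'\<close> by force
    qed
  qed (auto simp: coeff_pCons split: nat.split)
  moreover have "inj_on (\<lambda>(a, p). pCons a p) (UNIV \<times> ?S k)" by (auto simp: inj_on_def)
  ultimately show ?case using Suc by (simp add: card_image card_cartesian_product)
qed

lemma subspace_of_dimension_above:
  fixes V :: "('a::{field,finite} ^ 'n) set"
  assumes "vec.dim V \<le> k" "k \<le> CARD('n)"
  obtains A where "A \<in> lin_subspaces k" "V \<subseteq> A"
proof -
  obtain B where B: "B \<subseteq> V" "vec.independent B" "V \<subseteq> vec.span B" "card B = vec.dim V"
    using vec.basis_exists by blast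
  define B' where "B' = vec.extend_basis B"
  have B': "B \<subseteq> B'" "vec.independent B'" "vec.span B' = UNIV"
    using vec.extend_basis_superset vec.independent_extend_basis vec.span_extend_basis B(2)
    by (auto simp: B'_def)
  have "card B' = vec.dim (UNIV :: ('a ^ 'n) set)"
    using B' by (metis vec.dim_span_eq_card_independent)
  then have "card B' = CARD('n)" by (simp add: vec.dim_UNIV card_cart_basis)
  then obtain C where C: "B \<subseteq> C" "C \<subseteq> B'" "card C = k"
    using exists_subset_between[of B k B'] B' B(4) assms finite by auto
  have "vec.independent C" using vec.independent_mono[OF B'(2) C(2)] .
  then have "vec.span C \<in> lin_subspaces k"
    using C(3) by (simp add: lin_subspaces_def vec.dim_eq_card_independent)
  moreover have "V \<subseteq> vec.span C" using B(3) vec.span_mono[OF C(1)] by blast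
  ultimately show ?thesis by (rule that)
qed

lemma bounded_degree_vector_in_scalar_ext:
  fixes x :: "'n::finite \<Rightarrow> 'a::{field,finite} poly"
  assumes x: "\<And>i j. k \<le> j \<Longrightarrow> coeff (x i) j = 0" and "k \<le> CARD('n)"
  shows "\<exists>A\<in>lin_subspaces k. x \<in> scalar_ext A"
proof -
  define v where "v j = (\<chi> i. coeff (x i) j)" for j
  have "vec.dim (v ` {..<k}) \<le> card (v ` {..<k})" by (rule vec.dim_le_card') simp
  also have "\<dots> \<le> k" using card_image_le[of "{..<k}" v] by simp
  finally obtain A where A: "A \<in> lin_subspaces k" "v ` {..<k} \<subseteq> A"
    using subspace_of_dimension_above[OF _ assms(2)] by blast
  \<comment> \<open>Coefficient vectors may coincide, so \<open>z u\<close> collects all powers of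
    \<open>t\<close> that belong to the same vector \<open>u\<close>.\<close>
  define z where "z u = (\<Sum>j\<in>{j\<in>{..<k}. v j = u}. monom 1 j :: 'a poly)" for u
  have "x i = (\<Sum>u\<in>A. z u * [:u $ i:])" for i
  proof -
    have "(\<Sum>u\<in>A. z u * [:u $ i:]) = (\<Sum>u\<in>A. \<Sum>j\<in>{j\<in>{..<k}. v j = u}. monom 1 j * [:v j $ i:])"
      unfolding z_def sum_distrib_right by (intro sum.cong refl) auto
    also have "\<dots> = (\<Sum>j<k. monom 1 j * [:v j $ i:])"
      using sum.group[of "{..<k}" A v "\<lambda>j. monom 1 j * [:v j $ i:]"] A(2) by simp
    also have "\<dots> = (\<Sum>j<k. monom (coeff (x i) j) j)"
      by (simp add: v_def smult_monom)
    also have "\<dots> = x i"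
      using x by (auto simp: poly_eq_iff coeff_sum not_less)
    finally show ?thesis by simp
  qed
  then show ?thesis using A(1) by (auto simp: scalar_ext_def)
qed

text \<open>The grid consists of the vectors of polynomials of degree less than \<open>k\<close>: their coefficient
  vectors span a space of dimension at most \<open>k\<close>, so each of them lies in \<open>scalar_ext A\<close> for some
  \<open>k\<close>-dimensional \<open>A\<close>. This plays the role of the grid of points over the extension of degree \<open>k\<close>.\<close>
lemma form_vanishing_on_all_subspaces:
  fixes h :: "('n::finite \<Rightarrow> 'a::{field,finite} poly) \<Rightarrow> 'a poly"
  assumes "poly_fun False UNIV UNIV e h" "k \<le> CARD('n)"
    and van: "\<And>A w. A \<in> lin_subspaces k \<Longrightarrow> w \<in> scalar_ext A \<Longrightarrow> vanishes_to_order l h w"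
    and less: "e < l * CARD('a) ^ k"
  shows "h = (\<lambda>_. 0)"
proof (rule ccontr)
  assume "h \<noteq> (\<lambda>_. 0)"
  then obtain x0 where x0: "h x0 \<noteq> 0" by auto
  let ?S = "{p :: 'a poly. \<forall>j\<ge>k. coeff p j = 0}"
  have S: "finite ?S" "card ?S = CARD('a) ^ k" using card_polys_of_bounded_degree by auto
  have "vanishes_to_order l h x" if "x \<in> UNIV \<rightarrow>\<^sub>E ?S" for x
    using that bounded_degree_vector_in_scalar_ext[of k x] assms(2) van by (auto simp: PiE_iff)
  from schwartz_zippel_multiplicity[OF finite[of "UNIV :: 'n set"] S(1) assms(1) x0 this]
  have "(l * CARD('a) ^ k) * (CARD('a) ^ k) ^ CARD('n) \<le> e * (CARD('a) ^ k) ^ CARD('n)"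
    by (simp add: S card_funcsetE mult_ac)
  then show False using less by simp
qed

section \<open>Coefficients\<close>

definition forms_exps :: "nat \<Rightarrow> ('n::finite \<Rightarrow> nat) set" where
  "forms_exps e = {\<alpha>. (\<Sum>i\<in>UNIV. \<alpha> i) = e}"

definition low_exps :: "nat \<Rightarrow> ('n::finite \<Rightarrow> nat) set" where
  "low_exps d = {\<alpha>. (\<Sum>i\<in>UNIV. \<alpha> i) < d}"

definition eval_coeffs :: "('n \<Rightarrow> nat) set \<Rightarrow> (('n \<Rightarrow> nat) \<Rightarrow> 'a::comm_ring_1) \<Rightarrow> ('n::finite \<Rightarrow> 'a poly) \<Rightarrow> 'a poly" where
  "eval_coeffs M c x = (\<Sum>\<alpha>\<in>M. [:c \<alpha>:] * (\<Prod>i\<in>UNIV. x i ^ \<alpha> i))"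

abbreviation constants :: "'a::zero poly set" where
  "constants \<equiv> range (\<lambda>c. [:c:])"

lemma finite_forms_exps: "finite (forms_exps e :: ('n::finite \<Rightarrow> nat) set)"
proof (rule finite_subset)
  show "forms_exps e \<subseteq> (UNIV \<rightarrow>\<^sub>E {..e} :: ('n \<Rightarrow> nat) set)"
    by (auto simp: forms_exps_def intro!: member_le_sum)
qed (auto intro: finite_PiE)

lemma low_exps_eq_UN: "low_exps d = (\<Union>e<d. forms_exps e)"
  by (auto simp: low_exps_def forms_exps_def)

lemma finite_low_exps: "finite (low_exps d :: ('n::finite \<Rightarrow> nat) set)"
  by (simp add: low_exps_eq_UN finite_forms_exps)

lemma card_low_exps: "card (low_exps d :: ('n::finite \<Rightarrow> nat) set) = (\<Sum>e<d. card (forms_exps e :: ('n \<Rightarrow> nat) set))"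
  unfolding low_exps_eq_UN
  by (rule card_UN_disjoint) (auto simp: finite_forms_exps, auto simp: forms_exps_def)

lemma eval_coeffs_var:
  fixes c :: "('n::finite \<Rightarrow> nat) \<Rightarrow> 'a::comm_ring_1"
  assumes "finite M" "\<And>\<alpha>. \<alpha> \<in> M \<Longrightarrow> \<alpha>(i := Suc (\<alpha> i)) \<in> M'" "finite M'"
  shows "\<exists>c'. (\<lambda>x. x i * eval_coeffs M c x) = eval_coeffs M' c'"
proof
  define s where "s \<alpha> = \<alpha>(i := Suc (\<alpha> i))" for \<alpha> :: "'n \<Rightarrow> nat"
  define c' where "c' \<beta> = (if \<beta> \<in> s ` M then c (\<beta>(i := \<beta> i - 1)) else 0)" for \<beta>
  have inj: "inj s" by (rule inj_on_inverseI[of _ "\<lambda>\<beta>. \<beta>(i := \<beta> i - 1)"]) (simp add: s_def)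
  have m: "x i * (\<Prod>k\<in>UNIV. x k ^ \<alpha> k) = (\<Prod>k\<in>UNIV. x k ^ s \<alpha> k)" for x :: "'n \<Rightarrow> 'a poly" and \<alpha>
    by (simp add: prod.remove[of UNIV i] s_def mult.assoc)
  show "(\<lambda>x. x i * eval_coeffs M c x) = eval_coeffs M' c'"
  proof
    fix x
    have "eval_coeffs M' c' x = (\<Sum>\<beta>\<in>s ` M. [:c' \<beta>:] * (\<Prod>k\<in>UNIV. x k ^ \<beta> k))"
      unfolding eval_coeffs_def using assms by (intro sum.mono_neutral_right) (auto simp: c'_def s_def)
    also have "\<dots> = (\<Sum>\<alpha>\<in>M. [:c \<alpha>:] * (\<Prod>k\<in>UNIV. x k ^ s \<alpha> k))"
      using inj by (subst sum.reindex) (auto simp: inj_on_def c'_def s_def intro!: sum.cong)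
    also have "\<dots> = x i * eval_coeffs M c x"
      by (simp only: eval_coeffs_def sum_distrib_left m[symmetric] mult.left_commute)
    finally show "x i * eval_coeffs M c x = eval_coeffs M' c' x" by simp
  qed
qed

lemma eval_coeffs_add: "eval_coeffs M (\<lambda>\<alpha>. c \<alpha> + c' \<alpha>) x = eval_coeffs M c x + eval_coeffs M c' x"
  by (simp only: eval_coeffs_def sum.distrib[symmetric] distrib_right[symmetric]) simp

lemma eval_coeffs_diff: "eval_coeffs M (\<lambda>\<alpha>. c \<alpha> - c' \<alpha>) x = eval_coeffs M c x - eval_coeffs M c' x"
  by (simp only: eval_coeffs_def sum_subtractf[symmetric] left_diff_distrib[symmetric]) simp

lemma eval_coeffs_delta:
  assumes "finite M" "(\<lambda>_. 0) \<in> M"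
  shows "eval_coeffs M (\<lambda>\<alpha>. if \<alpha> = (\<lambda>_. 0) then a else 0) x = [:a:]"
proof -
  have "eval_coeffs M (\<lambda>\<alpha>. if \<alpha> = (\<lambda>_. 0) then a else 0) x = (\<Sum>\<alpha>\<in>M. if \<alpha> = (\<lambda>_. 0) then [:a:] else 0)"
    unfolding eval_coeffs_def by (intro sum.cong refl) auto
  then show ?thesis using assms by simp
qed

text \<open>The inductive description suits substitution, coefficient vectors suit counting; this is
  the passage from the former to the latter.\<close>

lemma poly_fun_imp_eval_coeffs:
  assumes "poly_fun hom constants UNIV d f"
  shows "\<exists>c. f = eval_coeffs (if hom then forms_exps d else low_exps (Suc d)) c"
  using assms
proof (induction rule: poly_fun.induct)
  case (const a d)
  let ?M = "if hom then forms_exps d else low_exps (Suc d) :: ('b \<Rightarrow> nat) set"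
  obtain a' where a: "a = [:a':]" using const by blast
  have fin: "finite ?M" by (simp add: finite_forms_exps finite_low_exps)
  show ?case
  proof (cases "a = 0")
    case True
    then show ?thesis by (intro exI[of _ "\<lambda>_. 0"]) (auto simp: eval_coeffs_def)
  next
    case False
    then have "(\<lambda>_. 0) \<in> ?M" using const by (auto simp: forms_exps_def low_exps_def)
    from eval_coeffs_delta[OF fin this] show ?thesis
      unfolding a by (intro exI[of _ "\<lambda>\<alpha>. if \<alpha> = (\<lambda>_. 0) then a' else 0"] ext) (rule sym)
  qed
next
  case (add d f g)
  then obtain c c' where "f = eval_coeffs (if hom then forms_exps d else low_exps (Suc d)) c"
    "g = eval_coeffs (if hom then forms_exps d else low_exps (Suc d)) c'"
    by blast
  then show ?case by (intro exI[of _ "\<lambda>\<alpha>. c \<alpha> + c' \<alpha>"] ext) (simp add: eval_coeffs_add)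
next
  case (var i d f)
  then obtain c where f: "f = eval_coeffs (if hom then forms_exps d else low_exps (Suc d)) c" by blast
  have s: "(\<Sum>k\<in>UNIV. (\<alpha>(i := Suc (\<alpha> i))) k) = Suc (\<Sum>k\<in>UNIV. \<alpha> k)" for \<alpha> :: "'b \<Rightarrow> nat"
    by (simp add: sum.remove[of UNIV i])
  show ?case unfolding f
    by (rule eval_coeffs_var) (auto simp: finite_forms_exps finite_low_exps, auto simp: forms_exps_def low_exps_def s simp del: fun_upd_apply)
qed

lemma poly_fun_power_prod:
  assumes "\<And>a b. a \<in> C \<Longrightarrow> b \<in> C \<Longrightarrow> a * b \<in> C" "1 \<in> C" "finite J" "J \<subseteq> I"
  shows "poly_fun hom C I (\<Sum>i\<in>J. \<alpha> i) (\<lambda>x. \<Prod>i\<in>J. x i ^ \<alpha> i)"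
  using assms(3,4)
proof (induction J rule: finite_induct)
  case empty
  then show ?case using assms(2) by (auto intro: poly_fun.const)
next
  case (insert j J)
  have "poly_fun hom C I n (\<lambda>x. x j ^ n)" for n
  proof (induction n)
    case 0 then show ?case using assms(2) by (auto intro: poly_fun.const)
  next
    case (Suc n) then show ?case using insert by (auto intro: poly_fun.var)
  qed
  with insert poly_fun_mult[OF assms(1) this[of "\<alpha> j"], of "sum \<alpha> J"] show ?case by simp
qed

lemma constants_mult: "a \<in> constants \<Longrightarrow> b \<in> constants \<Longrightarrow> a * b \<in> constants" for a :: "'a::comm_ring_1 poly"
  by auto

lemma poly_fun_eval_coeffs:
  assumes "\<And>\<alpha>. \<alpha> \<in> M \<Longrightarrow> (\<Sum>i\<in>UNIV. \<alpha> i) = d \<or> \<not> hom \<and> (\<Sum>i\<in>UNIV. \<alpha> i) \<le> d"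
  shows "poly_fun hom constants UNIV d (eval_coeffs M c)"
  unfolding eval_coeffs_def
proof (rule poly_fun_sum)
  fix \<alpha> assume "\<alpha> \<in> M"
  have "poly_fun hom constants UNIV (\<Sum>i\<in>UNIV. \<alpha> i) (\<lambda>x. [:c \<alpha>:] * (\<Prod>i\<in>UNIV. x i ^ \<alpha> i))"
    by (intro poly_fun_cmult[OF constants_mult] poly_fun_power_prod[OF constants_mult])
       (auto intro: range_eqI[of _ _ 1] simp: one_pCons)
  then show "poly_fun hom constants UNIV d (\<lambda>x. [:c \<alpha>:] * (\<Prod>i\<in>UNIV. x i ^ \<alpha> i))"
    using assms[OF \<open>\<alpha> \<in> M\<close>] poly_fun_mono[of _ _ "sum \<alpha> UNIV" _ d] by (elim disjE conjE) simp_all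
qed auto

text \<open>Reading off digits in base \<open>B\<close>: substituting \<open>t ^ \<omega> i\<close> for the variable \<open>i\<close> sends distinct
  monomials to distinct powers of \<open>t\<close>.\<close>
lemma kronecker_weights:
  assumes "finite I"
  shows "\<exists>\<omega> :: 'i \<Rightarrow> nat. \<forall>\<alpha> \<beta>. (\<forall>i\<in>I. \<alpha> i < B \<and> \<beta> i < B) \<longrightarrow>
    (\<Sum>i\<in>I. \<alpha> i * \<omega> i) = (\<Sum>i\<in>I. \<beta> i * \<omega> i) \<longrightarrow> (\<forall>i\<in>I. \<alpha> i = \<beta> i)"
  using assms
proof (induction I rule: finite_induct)
  case (insert j I)
  then obtain \<omega> where \<omega>: "\<And>\<alpha> \<beta> :: 'i \<Rightarrow> nat. (\<forall>i\<in>I. \<alpha> i < B \<and> \<beta> i < B) \<Longrightarrow>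
    (\<Sum>i\<in>I. \<alpha> i * \<omega> i) = (\<Sum>i\<in>I. \<beta> i * \<omega> i) \<Longrightarrow> (\<forall>i\<in>I. \<alpha> i = \<beta> i)"
    by blast
  \<comment> \<open>The new variable \<open>j\<close> becomes the least significant digit, recovered
    by reduction mod \<open>B\<close>.\<close>
  define \<omega>' where "\<omega>' i = (if i = j then 1 else B * \<omega> i)" for i
  have s: "(\<Sum>i\<in>insert j I. \<alpha> i * \<omega>' i) = \<alpha> j + B * (\<Sum>i\<in>I. \<alpha> i * \<omega> i)" for \<alpha>
  proof -
    have "(\<Sum>i\<in>I. \<alpha> i * \<omega>' i) = (\<Sum>i\<in>I. B * (\<alpha> i * \<omega> i))"
      using insert.hyps by (intro sum.cong refl) (auto simp: \<omega>'_def)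
    then show ?thesis using insert.hyps by (simp add: \<omega>'_def sum_distrib_left)
  qed
  have "\<forall>i\<in>insert j I. \<alpha> i = \<beta> i"
    if b: "\<forall>i\<in>insert j I. \<alpha> i < B \<and> \<beta> i < B"
      and eq: "(\<Sum>i\<in>insert j I. \<alpha> i * \<omega>' i) = (\<Sum>i\<in>insert j I. \<beta> i * \<omega>' i)" for \<alpha> \<beta>
  proof -
    have "\<alpha> j = (\<alpha> j + B * (\<Sum>i\<in>I. \<alpha> i * \<omega> i)) mod B" using b by simp
    also have "\<dots> = \<beta> j" using eq b unfolding s by simp
    finally have "\<alpha> j = \<beta> j" .
    moreover have "B > 0" using b by auto
    ultimately have "(\<Sum>i\<in>I. \<alpha> i * \<omega> i) = (\<Sum>i\<in>I. \<beta> i * \<omega> i)" using eq unfolding s by simp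
    with \<omega>[of \<alpha> \<beta>] b \<open>\<alpha> j = \<beta> j\<close> show ?thesis by simp
  qed
  then show ?case by blast
qed simp

text \<open>The Kronecker substitution is itself a point of \<open>F[t] ^ n\<close>, so evaluation
  at this single point already recovers all coefficients.\<close>

lemma eval_coeffs_inject:
  fixes c c' :: "('n::finite \<Rightarrow> nat) \<Rightarrow> 'a::comm_ring_1"
  assumes M: "M \<subseteq> low_exps B" and eq: "eval_coeffs M c = eval_coeffs M c'" and "\<alpha> \<in> M"
  shows "c \<alpha> = c' \<alpha>"
proof -
  obtain \<omega> :: "'n \<Rightarrow> nat" where \<omega>: "\<And>\<alpha> \<beta>. (\<forall>i\<in>UNIV. \<alpha> i < B \<and> \<beta> i < B) \<Longrightarrow>
    (\<Sum>i\<in>UNIV. \<alpha> i * \<omega> i) = (\<Sum>i\<in>UNIV. \<beta> i * \<omega> i) \<Longrightarrow> (\<forall>i\<in>UNIV. \<alpha> i = \<beta> i)"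
    using kronecker_weights[OF finite[of "UNIV :: 'n set"], of B] by blast
  have bound: "\<beta> i < B" if "\<beta> \<in> M" for \<beta> i
    using M that member_le_sum[of i UNIV \<beta>] by (force simp: low_exps_def)
  have fin: "finite M" using M finite_low_exps finite_subset by blast
  have co: "coeff (eval_coeffs M d (\<lambda>i. monom 1 (\<omega> i))) (\<Sum>i\<in>UNIV. \<alpha> i * \<omega> i) = d \<alpha>" for d :: "('n \<Rightarrow> nat) \<Rightarrow> 'a"
  proof -
    have "(\<Prod>i\<in>UNIV. monom (1::'a) (\<omega> i) ^ \<beta> i) = monom 1 (\<Sum>i\<in>UNIV. \<beta> i * \<omega> i)" for \<beta>
    proof -
      have "(\<Prod>i\<in>J. monom (1::'a) (\<omega> i) ^ \<beta> i) = monom 1 (\<Sum>i\<in>J. \<beta> i * \<omega> i)" for J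
        by (induction J rule: infinite_finite_induct) (auto simp: monom_power mult_monom mult.commute)
      then show ?thesis .
    qed
    then have "coeff (eval_coeffs M d (\<lambda>i. monom 1 (\<omega> i))) (\<Sum>i\<in>UNIV. \<alpha> i * \<omega> i) =
       (\<Sum>\<beta>\<in>M. if (\<Sum>i\<in>UNIV. \<beta> i * \<omega> i) = (\<Sum>i\<in>UNIV. \<alpha> i * \<omega> i) then d \<beta> else 0)"
      unfolding eval_coeffs_def coeff_sum by (intro sum.cong refl) (simp add: smult_monom)
    also have "\<dots> = (\<Sum>\<beta>\<in>M. if \<beta> = \<alpha> then d \<beta> else 0)"
      using \<omega>[of _ \<alpha>] bound \<open>\<alpha> \<in> M\<close> by (intro sum.cong refl if_cong) (auto simp: fun_eq_iff)
    also have "\<dots> = d \<alpha>" using fin \<open>\<alpha> \<in> M\<close> by simp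
    finally show ?thesis .
  qed
  show ?thesis using co[of c] co[of c'] eq by simp
qed

section \<open>Finite spaces of polynomials with coefficients in the field\<close>

definition forms :: "nat \<Rightarrow> (('n::finite \<Rightarrow> 'a::{field,finite} poly) \<Rightarrow> 'a poly) set" where
  "forms e = range (eval_coeffs (forms_exps e))"

definition low_polys :: "nat \<Rightarrow> (('n::finite \<Rightarrow> 'a::{field,finite} poly) \<Rightarrow> 'a poly) set" where
  "low_polys d = range (eval_coeffs (low_exps d))"

lemma forms_iff: "h \<in> forms e \<longleftrightarrow> poly_fun True constants UNIV e h"
  using poly_fun_imp_eval_coeffs[of True e h] poly_fun_eval_coeffs[of "forms_exps e" e True]
  by (auto simp: forms_def forms_exps_def)

lemma low_polys_Suc_iff: "f \<in> low_polys (Suc d) \<longleftrightarrow> poly_fun False constants UNIV d f"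
  using poly_fun_imp_eval_coeffs[of False d f] poly_fun_eval_coeffs[of "low_exps (Suc d)" d False]
  by (auto simp: low_polys_def low_exps_def less_Suc_eq_le)

lemma low_polys_0: "low_polys 0 = {\<lambda>_. 0}"
  by (auto simp: low_polys_def low_exps_def eval_coeffs_def fun_eq_iff)

lemma range_eval_coeffs:
  assumes "finite M"
  shows "range (eval_coeffs M) = eval_coeffs M ` (M \<rightarrow>\<^sub>E (UNIV :: 'a::comm_ring_1 set))"
proof -
  have "eval_coeffs M c \<in> eval_coeffs M ` (M \<rightarrow>\<^sub>E UNIV)" for c :: "_ \<Rightarrow> 'a"
  proof (rule image_eqI[of _ _ "restrict c M"])
    show "eval_coeffs M c = eval_coeffs M (restrict c M)"
      by (intro ext) (simp add: eval_coeffs_def)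
  qed simp
  then show ?thesis by auto
qed

lemma finite_forms: "finite (forms e :: (('n::finite \<Rightarrow> 'a::{field,finite} poly) \<Rightarrow> 'a poly) set)"
  and card_forms_le: "card (forms e :: (('n::finite \<Rightarrow> 'a::{field,finite} poly) \<Rightarrow> 'a poly) set)
    \<le> CARD('a) ^ card (forms_exps e :: ('n \<Rightarrow> nat) set)"
proof -
  let ?M = "forms_exps e :: ('n \<Rightarrow> nat) set"
  have "finite (?M \<rightarrow>\<^sub>E (UNIV :: 'a set))" by (intro finite_PiE finite_forms_exps) simp
  moreover have "forms e = eval_coeffs ?M ` (?M \<rightarrow>\<^sub>E (UNIV :: 'a set))"
    unfolding forms_def by (rule range_eval_coeffs[OF finite_forms_exps])
  moreover have "card (?M \<rightarrow>\<^sub>E (UNIV :: 'a set)) = CARD('a) ^ card ?M"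
    by (rule card_funcsetE[OF finite_forms_exps])
  ultimately show "finite (forms e :: (('n \<Rightarrow> 'a poly) \<Rightarrow> 'a poly) set)"
    "card (forms e :: (('n \<Rightarrow> 'a poly) \<Rightarrow> 'a poly) set) \<le> CARD('a) ^ card ?M"
    using card_image_le[of "?M \<rightarrow>\<^sub>E (UNIV :: 'a set)" "eval_coeffs ?M"] by auto
qed

text \<open>The exact count matters here, since it bounds the number of vanishing polynomials from
  below; for \<open>forms\<close> an upper bound suffices.\<close>

lemma card_low_polys: "card (low_polys d :: (('n::finite \<Rightarrow> 'a::{field,finite} poly) \<Rightarrow> 'a poly) set)
    = CARD('a) ^ card (low_exps d :: ('n \<Rightarrow> nat) set)"
proof -
  let ?M = "low_exps d :: ('n \<Rightarrow> nat) set"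
  have "inj_on (eval_coeffs ?M) (?M \<rightarrow>\<^sub>E (UNIV :: 'a set))"
    by (intro inj_onI PiE_ext) (auto dest: eval_coeffs_inject[OF order_refl])
  then show ?thesis
    by (simp add: low_polys_def range_eval_coeffs[OF finite_low_exps] card_image card_funcsetE[OF finite_low_exps])
qed

lemma finite_low_polys: "finite (low_polys d :: (('n::finite \<Rightarrow> 'a::{field,finite} poly) \<Rightarrow> 'a poly) set)"
  by (simp add: low_polys_def range_eval_coeffs[OF finite_low_exps]) (intro finite_imageI finite_PiE finite_low_exps, simp)

lemma low_polys_translate:
  fixes f :: "('n::finite \<Rightarrow> 'a::{field,finite} poly) \<Rightarrow> 'a poly"
  assumes "f \<in> low_polys d"
  shows "(\<lambda>x. f (\<lambda>i. x i + [:v i:])) \<in> low_polys d"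
proof (cases d)
  case 0
  then show ?thesis using assms by (auto simp: low_polys_0)
next
  case (Suc d')
  have "poly_fun False constants UNIV 1 (\<lambda>x. x i + [:v i:])" for i :: 'n
    using poly_fun.var[of i UNIV False constants 0 "\<lambda>_. 1"]
    by (intro poly_fun.add poly_fun.const) (auto intro!: poly_fun.const range_eqI[of _ _ 1] simp: one_pCons)
  then show ?thesis
    using assms poly_fun_comp[OF constants_mult, of False UNIV d' f UNIV "\<lambda>i x. x i + [:v i:]"]
    by (simp add: Suc low_polys_Suc_iff)
qed

lemma low_polys_diff: "f \<in> low_polys d \<Longrightarrow> g \<in> low_polys d \<Longrightarrow> f - g \<in> low_polys d"
  by (auto simp: low_polys_def image_iff fun_eq_iff eval_coeffs_diff[symmetric])

lemma forms_diff: "f \<in> forms d \<Longrightarrow> g \<in> forms d \<Longrightarrow> f - g \<in> forms d"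
  by (auto simp: forms_def image_iff fun_eq_iff eval_coeffs_diff[symmetric])

lemma low_polys_SucE:
  fixes f :: "('n::finite \<Rightarrow> 'a::{field,finite} poly) \<Rightarrow> 'a poly"
  assumes "f \<in> low_polys (Suc e)"
  obtains h g where "h \<in> forms e" "g \<in> low_polys e" "f = (\<lambda>x. h x + g x)"
proof -
  obtain c where "f = eval_coeffs (low_exps (Suc e)) c" using assms by (auto simp: low_polys_def)
  moreover have eq: "low_exps (Suc e) = forms_exps e \<union> (low_exps e :: ('n \<Rightarrow> nat) set)"
    and disj: "forms_exps e \<inter> (low_exps e :: ('n \<Rightarrow> nat) set) = {}"
    by (auto simp: low_exps_def forms_exps_def)
  have "eval_coeffs (low_exps (Suc e)) c x = eval_coeffs (forms_exps e) c x + eval_coeffs (low_exps e) c x" for x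
    unfolding eval_coeffs_def eq by (rule sum.union_disjoint[OF finite_forms_exps finite_low_exps disj])
  ultimately have "f = (\<lambda>x. eval_coeffs (forms_exps e) c x + eval_coeffs (low_exps e) c x)"
    by auto
  then show ?thesis by (intro that) (auto simp: forms_def low_polys_def)
qed

text \<open>Along a line through \<open>v\<close> the monomial with exponent \<open>\<alpha>\<close>
  contributes only to the power of the parameter equal to its total degree.\<close>

lemma vanishes_to_order_if_low_coeffs_zero:
  fixes f :: "('n::finite \<Rightarrow> 'a::{field,finite} poly) \<Rightarrow> 'a poly"
  assumes "\<And>x. f (\<lambda>i. x i + v i) = eval_coeffs M c x" and c: "\<And>\<alpha>. \<alpha> \<in> M \<inter> low_exps m \<Longrightarrow> c \<alpha> = 0"
  shows "vanishes_to_order m f v"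
proof (rule vanishes_to_orderI, intro exI conjI allI impI)
  fix u t
  let ?p = "\<Sum>\<alpha>\<in>M. monom ([:c \<alpha>:] * (\<Prod>i\<in>UNIV. u i ^ \<alpha> i)) (\<Sum>i\<in>UNIV. \<alpha> i)"
  show "f (\<lambda>i. v i + t * u i) = poly ?p t"
  proof -
    have "f (\<lambda>i. v i + t * u i) = eval_coeffs M c (\<lambda>i. t * u i)"
      using assms(1)[of "\<lambda>i. t * u i"] by (simp only: add.commute)
    also have "\<dots> = poly ?p t"
      unfolding eval_coeffs_def poly_sum poly_monom
      by (intro sum.cong refl) (simp only: power_mult_distrib prod.distrib power_sum mult_ac)
    finally show ?thesis .
  qed
  fix j assume "j < m"
  then show "coeff ?p j = 0"
    using c by (auto simp: coeff_sum low_exps_def intro!: sum.neutral)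
qed

section \<open>Forms vanishing on a fraction of the subspaces\<close>

definition diff_closed :: "'b::ab_group_add set \<Rightarrow> bool" where
  "diff_closed A \<longleftrightarrow> 0 \<in> A \<and> (\<forall>x\<in>A. \<forall>y\<in>A. x - y \<in> A)"

lemma diff_closed_Int: "diff_closed A \<Longrightarrow> diff_closed B \<Longrightarrow> diff_closed (A \<inter> B)"
  by (auto simp: diff_closed_def)

lemma diff_closed_INT: "(\<And>x. x \<in> S \<Longrightarrow> diff_closed (N x)) \<Longrightarrow> diff_closed (\<Inter>x\<in>S. N x)"
  by (auto simp: diff_closed_def)

text \<open>\<open>F\<close> sends \<open>(a, b)\<close> to \<open>a - b\<close> and to the offset
  of \<open>a\<close> from the representative \<open>(a', b')\<close> of that difference. The offset
  equals \<open>b - b'\<close>, hence lies in \<open>B \<inter> C\<close>. In terms of indices: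
  imposing \<open>C\<close> costs the larger group at least as much as the smaller one.\<close>

lemma card_Int_diff_closed_le:
  fixes A B C :: "'b::ab_group_add set"
  assumes fin: "finite A" and "diff_closed A" "diff_closed B" "diff_closed C" "B \<subseteq> A"
  shows "card (A \<inter> C) * card B \<le> card A * card (B \<inter> C)"
proof -
  let ?P = "(A \<inter> C) \<times> B"
  define \<sigma> where "\<sigma> v = (SOME p. p \<in> ?P \<and> fst p - snd p = v)" for v
  have \<sigma>: "\<sigma> (a - b) \<in> ?P \<and> fst (\<sigma> (a - b)) - snd (\<sigma> (a - b)) = a - b" if "(a, b) \<in> ?P" for a b
    unfolding \<sigma>_def by (rule someI_ex) (use that in force)
  define F where "F p = (fst p - snd p, fst p - fst (\<sigma> (fst p - snd p)))" for p
  have "card ?P \<le> card (A \<times> (B \<inter> C))"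
  proof (rule card_inj_on_le)
    show "inj_on F ?P"
      by (auto simp: inj_on_def F_def)
    show "F ` ?P \<subseteq> A \<times> (B \<inter> C)"
    proof
      fix y assume "y \<in> F ` ?P"
      then obtain a b where ab: "(a, b) \<in> ?P" "y = F (a, b)" by auto
      obtain a' b' where ab': "\<sigma> (a - b) = (a', b')" by fastforce
      have "(a', b') \<in> ?P" "a' - b' = a - b" using \<sigma>[OF ab(1)] ab' by auto
      moreover from this have "a - a' = b - b'" by (simp add: algebra_simps)
      ultimately have "a - a' \<in> B \<inter> C" using ab(1) assms(3,4) by (auto simp: diff_closed_def) metis
      moreover have "a - b \<in> A" using ab(1) assms(2,5) by (auto simp: diff_closed_def)
      ultimately show "y \<in> A \<times> (B \<inter> C)" using ab' by (simp add: ab(2) F_def)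
    qed
    show "finite (A \<times> (B \<inter> C))" using fin assms(5) finite_subset by blast
  qed
  then show ?thesis by (simp add: card_cartesian_product)
qed

lemma ln_add_le_of_mult_le:
  fixes a b c d :: nat
  assumes "a * b \<le> c * d" "0 < a" "0 < b" "0 < c" "0 < d"
  shows "ln (real a) + ln (real b) \<le> ln (real c) + ln (real d)"
proof -
  have "real a * real b \<le> real c * real d" using assms(1) by (metis of_nat_le_iff of_nat_mult)
  then have "ln (real a * real b) \<le> ln (real c * real d)" using assms by (intro ln_mono) auto
  then show ?thesis using assms by (simp add: ln_mult_pos)
qed

text \<open>Submodularity of the codimension, in the form used for Shearer's inequality: \<open>\<delta> x\<close> is the
  codimension gained at \<open>x\<close> in a fixed enumeration of \<open>X\<close>, which is at most the gain of \<open>x\<close> over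
  any smaller set.\<close>
lemma shearer_weights:
  fixes V :: "'b::ab_group_add set"
  assumes "finite X" and V: "finite V" "diff_closed V" and N: "\<And>x. x \<in> X \<Longrightarrow> diff_closed (N x)"
  shows "\<exists>\<delta>. (\<Sum>x\<in>X. \<delta> x) = ln (card V) - ln (card (V \<inter> (\<Inter>x\<in>X. N x))) \<and>
    (\<forall>S\<subseteq>X. ln (card (V \<inter> (\<Inter>x\<in>S. N x))) \<le> ln (card V) - (\<Sum>x\<in>S. \<delta> x))"
  using assms(1) N
proof (induction X rule: finite_induct)
  case empty
  then show ?case by simp
next
  case (insert x X)
  let ?M = "\<lambda>S. V \<inter> (\<Inter>x\<in>S. N x)"
  obtain \<delta> where \<delta>: "(\<Sum>x\<in>X. \<delta> x) = ln (card V) - ln (card (?M X))"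
    "\<And>S. S \<subseteq> X \<Longrightarrow> ln (card (?M S)) \<le> ln (card V) - (\<Sum>x\<in>S. \<delta> x)"
    using insert.IH insert.prems by auto
  define \<delta>' where "\<delta>' = \<delta>(x := ln (card (?M X)) - ln (card (?M (insert x X))))"
  have same: "(\<Sum>y\<in>S. \<delta>' y) = (\<Sum>y\<in>S. \<delta> y)" if "S \<subseteq> X" for S
    using that insert.hyps by (intro sum.cong refl) (auto simp: \<delta>'_def)
  have dc: "diff_closed (?M S)" if "S \<subseteq> insert x X" for S
    using that insert.prems by (intro diff_closed_Int V diff_closed_INT) auto
  have pos: "card (?M S) > 0" if "S \<subseteq> insert x X" for S
    using dc[OF that] V(1) by (auto simp: card_gt_0_iff diff_closed_def)
  have "ln (card (?M S)) \<le> ln (card V) - (\<Sum>y\<in>S. \<delta>' y)" if S: "S \<subseteq> insert x X" for S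
  proof (cases "x \<in> S")
    case False
    then have "S \<subseteq> X" using S by auto
    then show ?thesis using \<delta>(2) same by simp
  next
    case True
    define S' where "S' = S - {x}"
    have S': "S' \<subseteq> X" "S = insert x S'" "x \<notin> S'" using S True by (auto simp: S'_def)
    have eqs: "?M S = ?M S' \<inter> N x" "?M (insert x X) = ?M X \<inter> N x" using S' by auto
    \<comment> \<open>\<open>?M X\<close> is contained in \<open>?M S'\<close>, so the condition
      \<open>N x\<close> cuts the latter by at least the factor by which it cuts the former.\<close>
    have "card (?M S' \<inter> N x) * card (?M X) \<le> card (?M S') * card (?M X \<inter> N x)"
      using S' insert.prems V by (intro card_Int_diff_closed_le dc) auto
    then have "ln (card (?M S)) + ln (card (?M X)) \<le> ln (card (?M S')) + ln (card (?M (insert x X)))"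
      unfolding eqs[symmetric] using S S' by (intro ln_add_le_of_mult_le pos) auto
    moreover have "(\<Sum>y\<in>S. \<delta>' y) = \<delta>' x + (\<Sum>y\<in>S'. \<delta> y)"
      using S' finite_subset[OF S'(1) insert.hyps(1)] same[OF S'(1)] by simp
    moreover have "\<delta>' x = ln (card (?M X)) - ln (card (?M (insert x X)))" by (simp add: \<delta>'_def)
    ultimately show ?thesis using \<delta>(2)[OF S'(1)] by linarith
  qed
  moreover have "(\<Sum>y\<in>insert x X. \<delta>' y) = ln (card V) - ln (card (?M (insert x X)))"
    using insert.hyps same[of X] \<delta>(1) by (simp add: \<delta>'_def)
  ultimately show ?case by blast
qed

section \<open>The general linear group acting on subspaces and forms\<close>

lemma invertible_imp_inj: "invertible P \<Longrightarrow> inj ((*v) P)" for P :: "'a::field ^ 'n ^ 'n"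
  by (simp add: invertible_left_inverse matrix_left_invertible_injective)

lemma transitive_on_subspaces:
  fixes A B :: "('a::{field,finite} ^ 'n) set"
  assumes "A \<in> lin_subspaces k" "B \<in> lin_subspaces k"
  shows "\<exists>P. invertible P \<and> (*v) P ` A = B"
proof -
  have A: "vec.subspace A" "vec.dim A = k" and B: "vec.subspace B" "vec.dim B = k"
    using assms by (auto simp: lin_subspaces_def)
  obtain X where X: "finite X" "vec.independent X" "vec.span X = A" "card X = k"
    using vec.basis_subspace_exists[OF A(1)] A(2) by metis
  obtain Y where Y: "finite Y" "vec.independent Y" "vec.span Y = B" "card Y = k"
    using vec.basis_subspace_exists[OF B(1)] B(2) by metis
  obtain f where f: "bij_betw f X Y"
    using finite_same_card_bij[OF X(1) Y(1)] X(4) Y(4) by auto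
  then have "vec.independent (f ` X)" "inj_on f X" using Y by (auto simp: bij_betw_def)
  then obtain g where g: "Vector_Spaces.linear (*s) (*s) g" "inj g" "\<And>x. x \<in> X \<Longrightarrow> g x = f x"
    using vec.linear_independent_extend_inj[OF X(2)] by blast
  have "g ` A = vec.span (g ` X)" unfolding X(3)[symmetric] by (rule vec.linear_span_image[OF g(1), symmetric])
  also have "g ` X = Y" using g(3) f by (auto simp: bij_betw_def)
  finally have "g ` A = B" using Y(3) by simp
  moreover have "(*v) (matrix g) = g" using matrix_works[OF g(1)] by auto
  moreover have "invertible (matrix g)"
    using g(2) \<open>(*v) (matrix g) = g\<close> by (simp add: invertible_left_inverse matrix_left_invertible_injective)
  ultimately show ?thesis by metis
qed

lemma invertible_image_lin_subspaces:
  fixes P :: "'a::{field,finite} ^ 'n ^ 'n" and A :: "('a::{field,finite} ^ 'n) set"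
  assumes "invertible P" "A \<in> lin_subspaces k"
  shows "(*v) P ` A \<in> lin_subspaces k"
proof -
  have "inj ((*v) P)" using assms(1) by (rule invertible_imp_inj)
  then show ?thesis using assms(2)
    by (auto simp: lin_subspaces_def vec.subspace_image matrix_vector_mul_linear_gen
      intro!: vec.dim_image_eq inj_on_subset[of _ UNIV])
qed

text \<open>Left multiplication by an invertible matrix taking \<open>B\<close> to \<open>B'\<close>
  injects the matrices with \<open>P A = B\<close> into those with \<open>P A = B'\<close>; by
  transitivity all these fibres have the same size.\<close>

lemma card_invertible_into:
  fixes A :: "('a::{field,finite} ^ 'n) set"
  assumes A: "A \<in> lin_subspaces k" and D: "D \<subseteq> lin_subspaces k"
  shows "card {P :: 'a ^ 'n ^ 'n. invertible P \<and> (*v) P ` A \<in> D} * card (lin_subspaces k :: ('a ^ 'n) set set) =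
    card {P :: 'a ^ 'n ^ 'n. invertible P} * card D"
proof -
  define c where "c B = card {P :: 'a ^ 'n ^ 'n. invertible P \<and> (*v) P ` A = B}" for B
  have le: "c B \<le> c B'" if BB: "B \<in> lin_subspaces k" "B' \<in> lin_subspaces k" for B B'
  proof -
    obtain Q where Q: "invertible Q" "(*v) Q ` B = B'" using transitive_on_subspaces[OF BB] by blast
    obtain Q' where Q': "Q' ** Q = mat 1" using Q(1) by (auto simp: invertible_def)
    show ?thesis unfolding c_def
    proof (rule card_inj_on_le)
      show "inj_on ((**) Q) {P. invertible P \<and> (*v) P ` A = B}"
        by (rule inj_on_inverseI[of _ "(**) Q'"]) (simp add: matrix_mul_assoc Q')
      show "(**) Q ` {P. invertible P \<and> (*v) P ` A = B} \<subseteq> {P. invertible P \<and> (*v) P ` A = B'}"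
        using Q by (auto simp: invertible_mult matrix_vector_mul_assoc[symmetric] image_image)
    qed simp
  qed
  then have eq: "c B = c A" if "B \<in> lin_subspaces k" for B using A that by (simp add: antisym)
  have count: "card {P :: 'a ^ 'n ^ 'n. invertible P \<and> (*v) P ` A \<in> E} = card E * c A"
    if "E \<subseteq> lin_subspaces k" for E
  proof -
    have "{P :: 'a ^ 'n ^ 'n. invertible P \<and> (*v) P ` A \<in> E} = (\<Union>B\<in>E. {P. invertible P \<and> (*v) P ` A = B})"
      by auto
    then have "card {P :: 'a ^ 'n ^ 'n. invertible P \<and> (*v) P ` A \<in> E} = (\<Sum>B\<in>E. c B)"
      unfolding c_def by (simp only:) (rule card_UN_disjoint, auto)
    also have "\<dots> = (\<Sum>B\<in>E. c A)" using that eq by (intro sum.cong refl) auto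
    finally show ?thesis by simp
  qed
  have "{P :: 'a ^ 'n ^ 'n. invertible P} = {P. invertible P \<and> (*v) P ` A \<in> lin_subspaces k}"
    using invertible_image_lin_subspaces A by blast
  then show ?thesis using count[OF D] count[OF order_refl] by simp
qed

definition act :: "'a::{field,finite} ^ 'n ^ 'n \<Rightarrow> ('n \<Rightarrow> 'a poly) \<Rightarrow> 'n \<Rightarrow> 'a poly" where
  "act P x i = (\<Sum>j\<in>UNIV. x j * [:P $ i $ j:])"

lemma act_act: "act P (act Q x) = act (P ** Q) x"
proof
  fix i
  have "act P (act Q x) i = (\<Sum>j\<in>UNIV. (\<Sum>k\<in>UNIV. x k * [:Q $ j $ k:]) * [:P $ i $ j:])"
    by (simp only: act_def)
  also have "\<dots> = (\<Sum>j\<in>UNIV. \<Sum>k\<in>UNIV. x k * [:P $ i $ j * Q $ j $ k:])"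
    unfolding sum_distrib_right by (intro sum.cong refl) (simp add: mult.commute)
  also have "\<dots> = (\<Sum>k\<in>UNIV. \<Sum>j\<in>UNIV. x k * [:P $ i $ j * Q $ j $ k:])" by (rule sum.swap)
  also have "\<dots> = act (P ** Q) x i"
    by (simp only: act_def matrix_matrix_mult_def vec_lambda_beta sum_pCons_0[symmetric] sum_distrib_left)
  finally show "act P (act Q x) i = act (P ** Q) x i" .
qed

lemma act_mat_1: "act (mat 1) x = x"
proof
  fix i
  have "act (mat 1) x i = (\<Sum>j\<in>UNIV. if j = i then x j else 0)"
    unfolding act_def by (intro sum.cong refl) (auto simp: mat_def)
  then show "act (mat 1) x i = x i" by simp
qed

lemma act_scalar_ext:
  assumes "invertible P" "w \<in> scalar_ext A"
  shows "act P w \<in> scalar_ext ((*v) P ` A)"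
proof -
  obtain z where w: "w = (\<lambda>i. \<Sum>v\<in>A. z v * [:v $ i:])" using assms(2) by (auto simp: scalar_ext_def)
  have inj: "inj ((*v) P)" using assms(1) by (rule invertible_imp_inj)
  have "act P w i = (\<Sum>v\<in>(*v) P ` A. z (inv ((*v) P) v) * [:v $ i:])" for i
  proof -
    have "act P w i = (\<Sum>j\<in>UNIV. \<Sum>v\<in>A. z v * [:P $ i $ j * v $ j:])"
      by (simp only: act_def w sum_distrib_right mult.assoc) (simp add: mult.commute)
    also have "\<dots> = (\<Sum>v\<in>A. \<Sum>j\<in>UNIV. z v * [:P $ i $ j * v $ j:])" by (rule sum.swap)
    also have "\<dots> = (\<Sum>v\<in>A. z v * [:(P *v v) $ i:])"
      by (simp only: matrix_vector_mult_def vec_lambda_beta sum_pCons_0[symmetric] sum_distrib_left)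
    also have "\<dots> = (\<Sum>v\<in>(*v) P ` A. z (inv ((*v) P) v) * [:v $ i:])"
      using inj by (subst sum.reindex) (auto simp: inj_on_def)
    finally show ?thesis .
  qed
  then show ?thesis unfolding scalar_ext_def
    by (intro CollectI exI[of _ "\<lambda>v. z (inv ((*v) P) v)"] ext)
qed

definition forms_vanishing :: "nat \<Rightarrow> nat \<Rightarrow> ('a::{field,finite} ^ 'n) set set \<Rightarrow> (('n \<Rightarrow> 'a poly) \<Rightarrow> 'a poly) set" where
  "forms_vanishing e l D = {h \<in> forms e. \<forall>A\<in>D. \<forall>w\<in>scalar_ext A. vanishes_to_order l h w}"

text \<open>Composition with \<open>act P\<close> is injective, preserves forms with field
  coefficients, and pulls conditions on \<open>P A\<close> back to \<open>A\<close>.\<close>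

lemma card_forms_vanishing_pullback:
  fixes D :: "('a::{field,finite} ^ 'n) set set"
    and P :: "'a ^ 'n ^ 'n"
  assumes P: "invertible P"
  shows "card (forms_vanishing e l D) \<le> card (forms_vanishing e l {A. (*v) P ` A \<in> D})"
proof (rule card_inj_on_le)
  obtain P' where P': "P ** P' = mat 1" using P by (auto simp: invertible_def)
  have inv: "act P (act P' x) = x" for x by (simp add: act_act P' act_mat_1)
  show "inj_on (\<lambda>h x. h (act P x)) (forms_vanishing e l D)"
  proof (rule inj_onI, rule ext)
    fix h h' x assume "(\<lambda>x. h (act P x)) = (\<lambda>x. h' (act P x))"
    from fun_cong[OF this, of "act P' x"] show "h x = h' x" by (simp add: inv)
  qed
  show "(\<lambda>h x. h (act P x)) ` forms_vanishing e l D \<subseteq> forms_vanishing e l {A. (*v) P ` A \<in> D}"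
  proof (rule image_subsetI)
    fix h assume h: "h \<in> forms_vanishing e l D"
    have L: "poly_fun True constants UNIV 1 (\<lambda>x. act P x i)" for i
      unfolding act_def
    proof (rule poly_fun_sum)
      show "poly_fun True constants UNIV 1 (\<lambda>x. x j * [:P $ i $ j:])" for j
        unfolding One_nat_def by (rule poly_fun.var[OF UNIV_I poly_fun.const]) auto
    qed (auto intro: range_eqI[of _ _ 0])
    have "poly_fun True constants UNIV e h" using h by (simp add: forms_vanishing_def forms_iff)
    from poly_fun_comp[where L = "\<lambda>i x. act P x i", OF constants_mult this L]
    have "poly_fun True constants UNIV e (\<lambda>x. h (act P x))" .
    moreover have "vanishes_to_order l (\<lambda>x. h (act P x)) w" if "w \<in> scalar_ext A" "(*v) P ` A \<in> D" for A w
    proof -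
      have "vanishes_to_order l h (act P w)"
        using h that act_scalar_ext[OF P that(1)] by (auto simp: forms_vanishing_def)
      then show ?thesis
        using vanishes_to_order_affine[of l h "\<lambda>_. 0" w "\<lambda>j i. [:P $ i $ j:]" UNIV] by (simp add: act_def[abs_def])
    qed
    ultimately show "(\<lambda>x. h (act P x)) \<in> forms_vanishing e l {A. (*v) P ` A \<in> D}"
      by (auto simp: forms_vanishing_def forms_iff)
  qed
  show "finite (forms_vanishing e l {A. (*v) P ` A \<in> D})"
    using finite_forms by (rule finite_subset[rotated]) (auto simp: forms_vanishing_def)
qed

lemma forms_vanishing_antimono: "D \<subseteq> D' \<Longrightarrow> forms_vanishing e l D' \<subseteq> forms_vanishing e l D"
  by (auto simp: forms_vanishing_def)

lemma finite_forms_vanishing: "finite (forms_vanishing e l D)"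
  using finite_forms by (rule finite_subset[rotated]) (auto simp: forms_vanishing_def)

lemma zero_in_forms_vanishing:
  fixes D :: "('a::{field,finite} ^ 'n) set set"
  shows "0 \<in> forms_vanishing e l D"
proof -
  have "0 = eval_coeffs (forms_exps e) (\<lambda>_. 0)" by (simp add: eval_coeffs_def fun_eq_iff)
  then have "0 \<in> forms e" unfolding forms_def by blast
  moreover have "vanishes_to_order l 0 w" for w :: "'n \<Rightarrow> 'a poly"
    by (rule vanishes_to_orderI) (auto intro: exI[of _ 0])
  ultimately show ?thesis by (simp add: forms_vanishing_def)
qed

lemma diff_closed_forms_vanishing: "diff_closed (forms_vanishing e l D)"
  unfolding diff_closed_def
proof (intro conjI ballI zero_in_forms_vanishing)
  fix f g assume fg: "f \<in> forms_vanishing e l D" "g \<in> forms_vanishing e l D"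
  then have "poly_fun True constants UNIV e f" "poly_fun True constants UNIV e g"
    by (auto simp: forms_vanishing_def forms_iff)
  with fg show "f - g \<in> forms_vanishing e l D"
    by (auto simp: forms_vanishing_def forms_diff intro: vanishes_to_order_diff)
qed

text \<open>Averaging over the linear group, which acts transitively, turns Shearer's inequality into a
  bound that is linear in the density of \<open>D\<close>.\<close>
lemma ln_card_forms_vanishing_le:
  fixes D :: "('a::{field,finite} ^ 'n) set set"
  assumes D: "D \<subseteq> lin_subspaces k" and k: "k \<le> CARD('n)" and e: "e < l * CARD('a) ^ k"
  shows "ln (card (forms_vanishing e l D)) \<le>
    (1 - card D / card (lin_subspaces k :: ('a ^ 'n) set set)) *
      ln (card (forms e :: (('n \<Rightarrow> 'a poly) \<Rightarrow> 'a poly) set))"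
proof -
  let ?X = "lin_subspaces k :: ('a ^ 'n) set set"
  let ?V = "forms e :: (('n \<Rightarrow> 'a poly) \<Rightarrow> 'a poly) set"
  let ?G = "{P :: 'a ^ 'n ^ 'n. invertible P}"
  let ?F = "\<lambda>S. forms_vanishing e l S :: (('n \<Rightarrow> 'a poly) \<Rightarrow> 'a poly) set"
  have V: "?V = ?F {}" by (simp add: forms_vanishing_def)
  have M: "?V \<inter> (\<Inter>A\<in>S. ?F {A}) = ?F S" for S
    by (auto simp: forms_vanishing_def)
  have "\<exists>\<delta>. (\<Sum>A\<in>?X. \<delta> A) = ln (card ?V) - ln (card (?V \<inter> (\<Inter>A\<in>?X. ?F {A}))) \<and>
    (\<forall>S\<subseteq>?X. ln (card (?V \<inter> (\<Inter>A\<in>S. ?F {A}))) \<le> ln (card ?V) - (\<Sum>A\<in>S. \<delta> A))"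
    by (rule shearer_weights) (simp_all add: finite_forms diff_closed_forms_vanishing, simp add: V diff_closed_forms_vanishing)
  then obtain \<delta> where \<delta>: "(\<Sum>A\<in>?X. \<delta> A) = ln (card ?V) - ln (card (?F ?X))"
    "\<And>S. S \<subseteq> ?X \<Longrightarrow> ln (card (?F S)) \<le> ln (card ?V) - (\<Sum>A\<in>S. \<delta> A)"
    unfolding M by blast
  \<comment> \<open>Hence the weights distribute all of \<open>ln (card ?V)\<close> over the
    subspaces. Nothing is known about single weights, which is why averaging is needed.\<close>
  have "?F ?X = {0}"
  proof -
    have "h = 0" if h: "h \<in> ?F ?X" for h
    proof -
      have "poly_fun False UNIV UNIV e h"
        using h poly_fun_weaken[of True constants UNIV e h UNIV] poly_fun_inhomogeneous[of True UNIV UNIV e h]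
        by (auto simp: forms_vanishing_def forms_iff)
      from form_vanishing_on_all_subspaces[OF this k _ e] show ?thesis
        using h by (auto simp: forms_vanishing_def zero_fun_def)
    qed
    then show ?thesis using zero_in_forms_vanishing by blast
  qed
  then have sum: "(\<Sum>A\<in>?X. \<delta> A) = ln (card ?V)" using \<delta>(1) by simp
  have "?X \<noteq> {}" using subspace_of_dimension_above[of "{}" k] k by auto
  then have X: "card ?X > 0" by (simp add: card_gt_0_iff)
  have "mat 1 \<in> ?G" by (auto simp: invertible_def)
  then have G: "card ?G > 0" by (auto simp: card_gt_0_iff)
  have one: "ln (card (?F D)) \<le> ln (card ?V) - (\<Sum>A\<in>?X. if (*v) P ` A \<in> D then \<delta> A else 0)" if "P \<in> ?G" for P
  proof -
    have pos: "card (?F S) > 0" for S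
      using zero_in_forms_vanishing[of e l S] finite_forms_vanishing[of e l S] by (auto simp: card_gt_0_iff)
    have "card (?F D) \<le> card (?F {A. (*v) P ` A \<in> D})"
      using that by (intro card_forms_vanishing_pullback) simp
    also have "\<dots> \<le> card (?F {A\<in>?X. (*v) P ` A \<in> D})"
      by (intro card_mono finite_forms_vanishing forms_vanishing_antimono) auto
    finally have "ln (card (?F D)) \<le> ln (card (?F {A\<in>?X. (*v) P ` A \<in> D}))"
      using pos by (intro ln_mono) auto
    also have "\<dots> \<le> ln (card ?V) - (\<Sum>A\<in>{A\<in>?X. (*v) P ` A \<in> D}. \<delta> A)" by (rule \<delta>(2)) auto
    finally show ?thesis by (simp add: sum.inter_filter)
  qed
  have "card ?G * ln (card (?F D)) = (\<Sum>P\<in>?G. ln (card (?F D)))" by simp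
  also have "\<dots> \<le> (\<Sum>P\<in>?G. ln (card ?V) - (\<Sum>A\<in>?X. if (*v) P ` A \<in> D then \<delta> A else 0))"
    by (rule sum_mono) (rule one)
  also have "\<dots> = card ?G * ln (card ?V) - (\<Sum>A\<in>?X. \<Sum>P\<in>?G. if (*v) P ` A \<in> D then \<delta> A else 0)"
    by (simp add: sum_subtractf sum.swap[of _ ?G])
  \<comment> \<open>Each \<open>A\<close> is sent into \<open>D\<close> by the same fraction of the
    group, so every weight receives the same factor.\<close>
  also have "(\<Sum>A\<in>?X. \<Sum>P\<in>?G. if (*v) P ` A \<in> D then \<delta> A else 0) = (\<Sum>A\<in>?X. (card ?G * (card D / card ?X)) * \<delta> A)"
  proof (intro sum.cong refl)
    fix A assume A: "A \<in> ?X"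
    have "real (card {P\<in>?G. (*v) P ` A \<in> D}) * real (card ?X) = real (card ?G) * real (card D)"
      using card_invertible_into[OF A D] unfolding of_nat_mult[symmetric] by simp
    then have "real (card {P\<in>?G. (*v) P ` A \<in> D}) = card ?G * (card D / card ?X)"
      using X by (simp only: times_divide_eq_right eq_divide_eq) auto
    moreover have "(\<Sum>P\<in>?G. if (*v) P ` A \<in> D then \<delta> A else 0) = (\<Sum>P\<in>{P\<in>?G. (*v) P ` A \<in> D}. \<delta> A)"
      by (rule sum.inter_filter[symmetric]) simp
    ultimately show "(\<Sum>P\<in>?G. if (*v) P ` A \<in> D then \<delta> A else 0) = (card ?G * (card D / card ?X)) * \<delta> A"
      by simp
  qed
  also have "\<dots> = card ?G * (card D / card ?X) * ln (card ?V)"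
    by (simp only: sum_distrib_left[symmetric] sum)
  finally have "card ?G * ln (card (?F D)) \<le> card ?G * ((1 - card D / card ?X) * ln (card ?V))"
    by (simp add: algebra_simps)
  then show ?thesis using G by (simp only: mult_le_cancel_left_pos of_nat_0_less_iff)
qed

section \<open>Counting and the limit\<close>

lemma card_forms_exps:
  "card (forms_exps e :: ('n::finite \<Rightarrow> nat) set) = (CARD('n) + e - 1) choose e"
proof -
  have size: "size M = (\<Sum>i\<in>UNIV. count M i)" for M :: "'n multiset"
    unfolding size_multiset_overloaded_eq
    by (rule sum.mono_neutral_left) (auto simp: not_in_iff)
  have count: "count (Abs_multiset \<alpha>) = \<alpha>" for \<alpha> :: "'n \<Rightarrow> nat"
    by (rule count_Abs_multiset) simp
  have "bij_betw count (multisets_of_size (UNIV :: 'n set) e) (forms_exps e)"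
    by (rule bij_betwI[of _ _ _ Abs_multiset])
       (simp_all add: forms_exps_def multisets_of_size_def size count count_inverse)
  from bij_betw_same_card[OF this] show ?thesis
    using card_multisets_of_size[of "UNIV :: 'n set" e] by simp
qed

text \<open>The middle term is the product of the \<open>CARD('n)\<close> consecutive integers
  starting at \<open>d\<close>; both bounds have the same leading order, which is all that the limit
  sees.\<close>

lemma card_low_exps_bounds:
  shows "d ^ CARD('n) \<le> fact CARD('n) * card (low_exps d :: ('n::finite \<Rightarrow> nat) set)" (is ?A)
    and "fact CARD('n) * card (low_exps d :: ('n::finite \<Rightarrow> nat) set) \<le> (d + CARD('n)) ^ CARD('n)" (is ?B)
proof -
  have "?A \<and> ?B"
  proof (cases d)
    case 0
    then show ?thesis by (simp add: card_low_exps zero_power)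
  next
    case (Suc d')
    obtain n where n: "CARD('n) = Suc n" using zero_less_card_finite[where 'a = 'n] by (metis gr0_implies_Suc)
    have "card (low_exps d :: ('n \<Rightarrow> nat) set) = (\<Sum>e\<le>d'. (n + e) choose e)"
      by (simp add: card_low_exps card_forms_exps n Suc lessThan_Suc_atMost)
    also have "\<dots> = (Suc n + d') choose d'" using sum_choose_lower[of n d'] by simp
    also have "\<dots> = (Suc n + d') choose (Suc n)" using binomial_symmetric[of d' "Suc n + d'"] by simp
    finally have card: "card (low_exps d :: ('n \<Rightarrow> nat) set) = (Suc n + d') choose (Suc n)" .
    have "fact d' * (fact CARD('n) * card (low_exps d :: ('n \<Rightarrow> nat) set)) = (fact (Suc n + d') :: nat)"
      using binomial_fact_lemma[of "Suc n" "Suc n + d'"] unfolding card n by (simp add: mult_ac del: fact_Suc binomial_Suc_Suc)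
    then have "fact CARD('n) * card (low_exps d :: ('n \<Rightarrow> nat) set) = (fact (Suc n + d') :: nat) div fact d'"
      by (metis fact_nonzero nonzero_mult_div_cancel_left)
    also have "\<dots> = \<Prod>{Suc d'..Suc n + d'}" using fact_div_fact[of d' "Suc n + d'"] by (simp del: fact_Suc)
    finally have eq: "fact CARD('n) * card (low_exps d :: ('n \<Rightarrow> nat) set) = \<Prod>{Suc d'..Suc n + d'}" .
    have "d ^ CARD('n) = (\<Prod>i\<in>{Suc d'..Suc n + d'}. d)" by (simp add: n)
    also have "\<dots> \<le> (\<Prod>i\<in>{Suc d'..Suc n + d'}. i)" by (rule prod_mono) (simp add: Suc)
    finally have ?A using eq by simp
    moreover have "(\<Prod>i\<in>{Suc d'..Suc n + d'}. i) \<le> (\<Prod>i\<in>{Suc d'..Suc n + d'}. d + CARD('n))"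
      by (rule prod_mono) (simp add: Suc n)
    then have ?B using eq by (simp add: n)
    ultimately show ?thesis by blast
  qed
  then show ?A ?B by auto
qed

section \<open>Two counts of the polynomials vanishing on K\<close>

definition polys_vanishing_on :: "nat \<Rightarrow> nat \<Rightarrow> ('a::{field,finite} ^ 'n) set \<Rightarrow> (('n \<Rightarrow> 'a poly) \<Rightarrow> 'a poly) set" where
  "polys_vanishing_on d m K = {f \<in> low_polys d. \<forall>v\<in>K. vanishes_to_order m f (\<lambda>i. [:v $ i:])}"

lemma low_polysD: "f \<in> low_polys d \<Longrightarrow> \<exists>e. poly_fun False constants UNIV e f"
  using poly_fun.const[of 0 constants False 0] by (cases d) (auto simp: low_polys_0 low_polys_Suc_iff)

lemma finite_polys_vanishing_on: "finite (polys_vanishing_on d m K)"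
  using finite_low_polys by (rule finite_subset[rotated]) (auto simp: polys_vanishing_on_def)

lemma polys_vanishing_on_diff:
  assumes "f \<in> polys_vanishing_on d m K" "g \<in> polys_vanishing_on d m K"
  shows "f - g \<in> polys_vanishing_on d m K"
proof -
  obtain e e' where "poly_fun False constants UNIV e f" "poly_fun False constants UNIV e' g"
    using assms low_polysD by (fastforce simp: polys_vanishing_on_def)
  then show ?thesis using assms
    by (auto simp: polys_vanishing_on_def low_polys_diff intro: vanishes_to_order_diff)
qed

text \<open>Filtering by degree, the graded pieces are the spaces of leading forms.\<close>
lemma card_polys_vanishing_on_le:
  fixes K :: "('a::{field,finite} ^ 'n) set"
  assumes "\<And>e h f. e < d \<Longrightarrow> h \<in> forms e \<Longrightarrow> f \<in> low_polys e \<Longrightarrow>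
      (\<And>v. v \<in> K \<Longrightarrow> vanishes_to_order m (\<lambda>x. h x + f x) (\<lambda>i. [:v $ i:])) \<Longrightarrow> h \<in> forms_vanishing e l D"
  shows "card (polys_vanishing_on d m K) \<le> (\<Prod>e<d. card (forms_vanishing e l D))"
  using assms
proof (induction d)
  case 0
  have "polys_vanishing_on 0 m K \<subseteq> {\<lambda>_. 0}" by (auto simp: polys_vanishing_on_def low_polys_0)
  then have "card (polys_vanishing_on 0 m K) \<le> card {\<lambda>_ :: 'n \<Rightarrow> 'a poly. 0 :: 'a poly}"
    by (rule card_mono[rotated]) simp
  then show ?case by simp
next
  case (Suc e)
  let ?W = "\<lambda>d. polys_vanishing_on d m K"
  \<comment> \<open>One member is fixed for each leading form; any other with the same leading form
    differs from it by an element of \<open>?W e\<close>.\<close>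
  define lift where "lift h = (SOME f. f \<in> ?W (Suc e) \<and> f - h \<in> low_polys e)" for h
  have "?W (Suc e) \<subseteq> (\<lambda>(h, g). lift h + g) ` (forms_vanishing e l D \<times> ?W e)"
  proof
    fix f assume f: "f \<in> ?W (Suc e)"
    then have "f \<in> low_polys (Suc e)" by (simp add: polys_vanishing_on_def)
    then obtain h g where hg: "h \<in> forms e" "g \<in> low_polys e" "f = (\<lambda>x. h x + g x)"
      by (rule low_polys_SucE)
    have h: "h \<in> forms_vanishing e l D"
      using f hg by (intro Suc.prems[of e h g]) (auto simp: polys_vanishing_on_def)
    have "f - h = g" using hg(3) by (simp add: fun_eq_iff)
    then have "\<exists>f. f \<in> ?W (Suc e) \<and> f - h \<in> low_polys e" using f hg(2) by auto
    then have lift: "lift h \<in> ?W (Suc e)" "lift h - h \<in> low_polys e"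
      unfolding lift_def by (metis (mono_tags, lifting) someI_ex)+
    have "f - lift h = g - (lift h - h)" using hg(3) by (simp add: fun_eq_iff)
    then have "f - lift h \<in> low_polys e" using low_polys_diff[OF hg(2) lift(2)] by (simp only:)
    then have "f - lift h \<in> ?W e"
      using polys_vanishing_on_diff[OF f lift(1)] by (simp add: polys_vanishing_on_def)
    then show "f \<in> (\<lambda>(h, g). lift h + g) ` (forms_vanishing e l D \<times> ?W e)"
      using h by (intro image_eqI[of _ _ "(h, f - lift h)"]) auto
  qed
  then have "card (?W (Suc e)) \<le> card (forms_vanishing e l D \<times> ?W e)"
    by (rule surj_card_le[rotated]) (simp add: finite_forms_vanishing finite_polys_vanishing_on)
  also have "\<dots> \<le> card (forms_vanishing e l D) * (\<Prod>e<e. card (forms_vanishing e l D))"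
    using Suc by (simp add: card_cartesian_product)
  finally show ?case by (simp add: mult.commute)
qed

text \<open>\<open>\<Phi>\<close> records the Taylor coefficients of order below \<open>m\<close> at
  each point of \<open>K\<close>. Polynomials with equal records differ by one vanishing there to
  order \<open>m\<close>, so no fibre of \<open>\<Phi>\<close> exceeds
  \<open>polys_vanishing_on d m K\<close>.\<close>

lemma card_le_polys_vanishing_on:
  fixes K :: "('a::{field,finite} ^ 'n) set"
  shows "CARD('a) ^ card (low_exps d :: ('n \<Rightarrow> nat) set) \<le>
    (CARD('a) ^ card (low_exps m :: ('n \<Rightarrow> nat) set)) ^ card K * card (polys_vanishing_on d m K)"
proof -
  let ?V = "low_polys d :: (('n \<Rightarrow> 'a poly) \<Rightarrow> 'a poly) set"
  let ?M = "low_exps m :: ('n \<Rightarrow> nat) set"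
  have "\<exists>c. (\<lambda>x. f (\<lambda>i. x i + [:v $ i:])) = eval_coeffs (low_exps d) c" if "f \<in> ?V" for f v
  proof -
    have "(\<lambda>x. f (\<lambda>i. x i + [:v $ i:])) \<in> range (eval_coeffs (low_exps d))"
      using low_polys_translate[OF that, of "\<lambda>i. v $ i"] unfolding low_polys_def .
    then show ?thesis by (rule imageE) blast
  qed
  note ex = this
  define c where "c f v = (SOME c. (\<lambda>x. f (\<lambda>i. x i + [:v $ i:])) = eval_coeffs (low_exps d) c)"
    for f :: "('n \<Rightarrow> 'a poly) \<Rightarrow> 'a poly" and v
  have c: "(\<lambda>x. f (\<lambda>i. x i + [:v $ i:])) = eval_coeffs (low_exps d) (c f v)" if "f \<in> ?V" for f v
    unfolding c_def by (rule someI_ex[OF ex[OF that]])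
  define \<Phi> where "\<Phi> f = (\<lambda>v\<in>K. \<lambda>\<alpha>\<in>?M. c f v \<alpha>)" for f
  define \<sigma> where "\<sigma> y = (SOME f. f \<in> ?V \<and> \<Phi> f = y)" for y
  have \<sigma>: "\<sigma> (\<Phi> f) \<in> ?V \<and> \<Phi> (\<sigma> (\<Phi> f)) = \<Phi> f" if "f \<in> ?V" for f
    using someI[of "\<lambda>g. g \<in> ?V \<and> \<Phi> g = \<Phi> f" f] that unfolding \<sigma>_def by blast
  let ?T = "K \<rightarrow>\<^sub>E (?M \<rightarrow>\<^sub>E (UNIV :: 'a set))"
  have fT: "finite ?T" by (intro finite_PiE finite_low_exps) simp_all
  have diff: "f - g \<in> polys_vanishing_on d m K" if fg: "f \<in> ?V" "g \<in> ?V" "\<Phi> f = \<Phi> g" for f g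
  proof -
    have "vanishes_to_order m (f - g) (\<lambda>i. [:v $ i:])" if v: "v \<in> K" for v
    proof (rule vanishes_to_order_if_low_coeffs_zero)
      show "(f - g) (\<lambda>i. x i + [:v $ i:]) = eval_coeffs (low_exps d) (\<lambda>\<alpha>. c f v \<alpha> - c g v \<alpha>) x" for x
        using fun_cong[OF c[OF fg(1), of v], of x] fun_cong[OF c[OF fg(2), of v], of x]
        by (simp add: eval_coeffs_diff)
      fix \<alpha> assume "\<alpha> \<in> low_exps d \<inter> ?M"
      then show "c f v \<alpha> - c g v \<alpha> = 0"
        using fun_cong[OF fun_cong[OF fg(3), of v], of \<alpha>] v by (simp add: \<Phi>_def)
    qed
    then show ?thesis using low_polys_diff[OF fg(1,2)] by (simp add: polys_vanishing_on_def)
  qed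
  have "card ?V \<le> card (?T \<times> polys_vanishing_on d m K)"
  proof (rule card_inj_on_le)
    show "inj_on (\<lambda>f. (\<Phi> f, f - \<sigma> (\<Phi> f))) ?V" by (rule inj_onI) auto
    show "(\<lambda>f. (\<Phi> f, f - \<sigma> (\<Phi> f))) ` ?V \<subseteq> ?T \<times> polys_vanishing_on d m K"
    proof (rule image_subsetI)
      fix f assume f: "f \<in> ?V"
      have "\<Phi> f \<in> ?T" by (simp add: \<Phi>_def)
      moreover have "f - \<sigma> (\<Phi> f) \<in> polys_vanishing_on d m K"
        using \<sigma>[OF f] f by (intro diff) auto
      ultimately show "(\<Phi> f, f - \<sigma> (\<Phi> f)) \<in> ?T \<times> polys_vanishing_on d m K" by simp
    qed
    show "finite (?T \<times> polys_vanishing_on d m K)" using fT finite_polys_vanishing_on by blast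
  qed
  then show ?thesis
    by (simp add: card_low_polys card_cartesian_product card_funcsetE finite_low_exps)
qed

text \<open>The conditions on \<open>K\<close> bound the vanishing polynomials from below, their
  leading forms bound them from above. On the logarithmic scale each degree keeps at most a
  \<open>1 - \<beta>\<close> share of its forms, so the conditions must account for the share
  \<open>\<beta>\<close>.\<close>

lemma furstenberg_exponent_bound:
  fixes K :: "('a::{field,finite} ^ 'n) set"
  assumes k: "k \<le> CARD('n)" and "0 \<le> \<gamma>" and furst: "furstenberg k (\<gamma> * real CARD('a) ^ k) \<beta> K"
    and d: "d \<le> l * CARD('a) ^ k" "real d \<le> real (m - l) * \<gamma> * real CARD('a)"
  shows "\<beta> * card (low_exps d :: ('n \<Rightarrow> nat) set) \<le> real (card K) * real (card (low_exps m :: ('n \<Rightarrow> nat) set))"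
proof -
  let ?X = "lin_subspaces k :: ('a ^ 'n) set set"
  let ?M = "\<lambda>d. low_exps d :: ('n \<Rightarrow> nat) set"
  let ?F = "\<lambda>e. forms_exps e :: ('n \<Rightarrow> nat) set"
  let ?L = "ln (real CARD('a))"
  define D where "D = {A \<in> ?X. \<exists>a. rich (\<gamma> * real CARD('a) ^ k) K ((\<lambda>x. a + x) ` A)}"
  have D: "D \<subseteq> ?X" by (auto simp: D_def)
  \<comment> \<open>\<open>k \<le> CARD('n)\<close> provides a subspace, so the fraction
    \<open>card D / card ?X\<close> makes sense.\<close>
  obtain A0 where "A0 \<in> ?X" using subspace_of_dimension_above[of "{}" k] k by auto
  then have "card ?X > 0" by (auto simp: card_gt_0_iff)
  then have beta: "\<beta> \<le> card D / card ?X" using furst by (simp add: furstenberg_def D_def field_simps)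
  have "CARD('a) \<ge> 2"
    using card_mono[of UNIV "{0, 1 :: 'a}"] by simp
  then have L: "?L > 0" by simp
  have pos: "card (forms_vanishing e l D) > 0" for e
    using zero_in_forms_vanishing[of e l D] finite_forms_vanishing[of e l D] by (auto simp: card_gt_0_iff)
  have lead: "card (polys_vanishing_on d m K) \<le> (\<Prod>e<d. card (forms_vanishing e l D))"
  proof (rule card_polys_vanishing_on_le)
    fix e and h f :: "('n \<Rightarrow> 'a poly) \<Rightarrow> 'a poly"
    assume e: "e < d" and h: "h \<in> forms e" and f: "f \<in> low_polys e"
      and van: "\<And>v. v \<in> K \<Longrightarrow> vanishes_to_order m (\<lambda>x. h x + f x) (\<lambda>i. [:v $ i:])"
    have h': "poly_fun True UNIV UNIV e h"
      using h poly_fun_weaken[of True constants UNIV e h UNIV] by (simp add: forms_iff)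
    have f': "poly_fun False UNIV UNIV (e - 1) f" "e = 0 \<Longrightarrow> f = (\<lambda>_. 0)"
      using f poly_fun_weaken[of False constants UNIV "e - 1" f UNIV]
      by (cases e; auto simp: low_polys_0 low_polys_Suc_iff intro: poly_fun.const)+
    have num: "real e < real (m - i) * \<gamma> * real CARD('a)" if "i < l" for i
    proof -
      have "real e < real d" using e by simp
      also have "\<dots> \<le> real (m - l) * \<gamma> * real CARD('a)" by (rule d)
      also have "\<dots> \<le> real (m - i) * \<gamma> * real CARD('a)"
        using that \<open>0 \<le> \<gamma>\<close> by (intro mult_right_mono) auto
      finally show ?thesis .
    qed
    have "vanishes_to_order l h w" if "A \<in> D" "w \<in> scalar_ext A" for A w
      using that leading_form_vanishes[OF _ _ h' f' van num] by (auto simp: D_def)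
    then show "h \<in> forms_vanishing e l D" using h by (simp add: forms_vanishing_def)
  qed
  have factor: "ln (card (forms_vanishing e l D)) \<le> (1 - \<beta>) * (card (?F e) * ?L)" if "e < d" for e
  proof -
    have "0 \<in> (forms e :: (('n \<Rightarrow> 'a poly) \<Rightarrow> 'a poly) set)"
      using zero_in_forms_vanishing[of e l D] by (simp add: forms_vanishing_def)
    then have V: "card (forms e :: (('n \<Rightarrow> 'a poly) \<Rightarrow> 'a poly) set) > 0"
      using finite_forms by (auto simp: card_gt_0_iff)
    have le1: "card D / card ?X \<le> 1"
      using card_mono[OF _ D] by (simp add: divide_le_eq)
    have "ln (card (forms_vanishing e l D)) \<le> (1 - card D / card ?X) * ln (card (forms e :: (('n \<Rightarrow> 'a poly) \<Rightarrow> 'a poly) set))"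
      using that d(1) by (intro ln_card_forms_vanishing_le D k) simp
    also have "\<dots> \<le> (1 - card D / card ?X) * (card (?F e) * ?L)"
    proof (rule mult_left_mono)
      have "real (card (forms e :: (('n \<Rightarrow> 'a poly) \<Rightarrow> 'a poly) set)) \<le> real CARD('a) ^ card (?F e)"
        using card_forms_le by (metis of_nat_le_iff of_nat_power)
      then have "ln (card (forms e :: (('n \<Rightarrow> 'a poly) \<Rightarrow> 'a poly) set)) \<le> ln (real CARD('a) ^ card (?F e))"
        using V by (intro ln_mono) auto
      then show "ln (card (forms e :: (('n \<Rightarrow> 'a poly) \<Rightarrow> 'a poly) set)) \<le> card (?F e) * ?L"
        by (simp add: ln_realpow)
    qed (use le1 in simp)
    also have "\<dots> \<le> (1 - \<beta>) * (card (?F e) * ?L)"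
      using beta L by (intro mult_right_mono) auto
    finally show ?thesis .
  qed
  have "CARD('a) ^ card (?M d) \<le> (CARD('a) ^ card (?M m)) ^ card K * (\<Prod>e<d. card (forms_vanishing e l D))"
    using card_le_polys_vanishing_on[where d = d and m = m and K = K] mult_le_mono2[OF lead] by (rule le_trans)
  then have "real CARD('a) ^ card (?M d) \<le> (real CARD('a) ^ card (?M m)) ^ card K * (\<Prod>e<d. real (card (forms_vanishing e l D)))"
    by (simp only: of_nat_power[symmetric] of_nat_prod[symmetric] of_nat_mult[symmetric] of_nat_le_iff)
  then have "ln (real CARD('a) ^ card (?M d)) \<le> ln ((real CARD('a) ^ card (?M m)) ^ card K * (\<Prod>e<d. real (card (forms_vanishing e l D))))"
    by (intro ln_mono) auto
  also have "\<dots> = card K * (card (?M m) * ?L) + ln (\<Prod>e<d. real (card (forms_vanishing e l D)))"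
    using pos by (subst ln_mult_pos) (auto simp: ln_realpow intro!: prod_pos)
  also have "ln (\<Prod>e<d. real (card (forms_vanishing e l D))) = (\<Sum>e<d. ln (card (forms_vanishing e l D)))"
    using pos by (intro ln_prod) (auto simp: less_imp_neq)
  also have "\<dots> \<le> (\<Sum>e<d. (1 - \<beta>) * (card (?F e) * ?L))" by (rule sum_mono) (use factor in simp)
  also have "\<dots> = (1 - \<beta>) * (card (?M d) * ?L)"
    by (simp add: card_low_exps sum_distrib_left sum_distrib_right)
  finally have "card (?M d) * ?L \<le> card K * (card (?M m) * ?L) + (1 - \<beta>) * (card (?M d) * ?L)"
    by (simp add: ln_realpow)
  then have "(\<beta> * card (?M d)) * ?L \<le> (card K * card (?M m)) * ?L" by (simp add: algebra_simps)
  then show ?thesis using L by (simp only: mult_le_cancel_right_pos of_nat_mult)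
qed

theorem mainTheorem13:
  fixes K :: "('a::{field,finite} ^ 'n) set"
    and k :: nat and \<gamma> \<beta> :: real
  assumes "1 \<le> k" and "k \<le> CARD('n)"
    and "0 \<le> \<gamma>" "\<gamma> \<le> 1" "0 \<le> \<beta>" "\<beta> \<le> 1"
    and "furstenberg k (\<gamma> * real CARD('a) ^ k) \<beta> K"
  shows "real (card K) \<ge> \<beta> * \<gamma> ^ CARD('n) * real CARD('a) ^ CARD('n)
            / (1 + 1 / real CARD('a) ^ (k - 1)) ^ CARD('n)"
proof (cases "\<gamma> = 0")
  \<comment> \<open>The value 0 is split off because \<open>m\<close> is obtained by dividing by
    \<open>\<gamma>\<close>.\<close>
  case True
  then show ?thesis by (simp add: zero_power)
next
  case False
  then have \<gamma>: "\<gamma> > 0" using assms(3) by simp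
  let ?q = "real CARD('a)" and ?n = "CARD('n)"
  \<comment> \<open>Up to rounding \<open>m = t * B\<close>: \<open>t\<close> for the order kept on
    the subspaces, the rest for the degree \<open>d = t * q ^ k\<close> divided by
    \<open>\<gamma> * q\<close>.\<close>
  define B where "B = 1 + ?q ^ k / (\<gamma> * ?q)"
  have q: "?q > 0" by simp
  have "B > 0" using \<gamma> q by (simp add: B_def add_pos_nonneg)
  have bound: "\<beta> * (real t * ?q ^ k / (real t * B + 1 + ?n)) ^ ?n \<le> real (card K)" for t
  proof -
    define d where "d = t * CARD('a) ^ k"
    define m where "m = t + nat \<lceil>real d / (\<gamma> * ?q)\<rceil>"
    have "real d / (\<gamma> * ?q) \<le> real (m - t)" by (simp add: m_def real_nat_ceiling_ge)
    then have dm: "real d \<le> real (m - t) * \<gamma> * ?q" using \<gamma> q by (simp add: field_simps)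
    have "real m \<le> real t + (real d / (\<gamma> * ?q) + 1)"
      using \<gamma> q by (simp add: m_def)
    also have "\<dots> = real t * B + 1" by (simp add: d_def B_def algebra_simps)
    finally have m: "real m + ?n \<le> real t * B + 1 + ?n" by simp
    have "\<beta> * real d ^ ?n \<le> \<beta> * (fact ?n * card (low_exps d :: ('n \<Rightarrow> nat) set))"
    proof (rule mult_left_mono)
      have "real (d ^ ?n) \<le> real (fact ?n * card (low_exps d :: ('n \<Rightarrow> nat) set))"
        by (simp only: of_nat_le_iff card_low_exps_bounds)
      then show "real d ^ ?n \<le> fact ?n * card (low_exps d :: ('n \<Rightarrow> nat) set)" by simp
    qed (use assms in simp)
    also have "\<dots> = fact ?n * (\<beta> * card (low_exps d :: ('n \<Rightarrow> nat) set))" by simp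
    also have "\<dots> \<le> fact ?n * (real (card K) * real (card (low_exps m :: ('n \<Rightarrow> nat) set)))"
      using assms dm by (intro mult_left_mono furstenberg_exponent_bound[where l = t and k = k]) (auto simp: d_def)
    also have "\<dots> = card K * real (fact ?n * card (low_exps m :: ('n \<Rightarrow> nat) set))" by simp
    also have "\<dots> \<le> card K * real ((m + ?n) ^ ?n)"
      by (intro mult_left_mono) (simp_all only: of_nat_le_iff card_low_exps_bounds of_nat_0_le_iff)
    also have "\<dots> \<le> card K * (real t * B + 1 + ?n) ^ ?n"
      using m by (intro mult_left_mono) (auto simp only: of_nat_power of_nat_add of_nat_0_le_iff intro!: power_mono)
    finally have "\<beta> * real d ^ ?n \<le> card K * (real t * B + 1 + ?n) ^ ?n" .
    moreover have "real t * B + 1 + ?n > 0" using \<open>B > 0\<close> by (simp add: add_nonneg_pos)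
    ultimately show ?thesis by (simp add: power_divide divide_le_eq d_def)
  qed
  have "(\<lambda>t. real t / (real t * B + 1 + ?n)) \<longlonglongrightarrow> 1 / B"
    using \<open>B > 0\<close> by real_asymp (simp add: divide_inverse)
  then have "(\<lambda>t. \<beta> * (?q ^ k * (real t / (real t * B + 1 + ?n))) ^ ?n) \<longlonglongrightarrow> \<beta> * (?q ^ k * (1 / B)) ^ ?n"
    by (rule tendsto_mult[OF tendsto_const tendsto_power[OF tendsto_mult[OF tendsto_const]]])
  then have "\<beta> * (?q ^ k * (1 / B)) ^ ?n \<le> real (card K)"
  proof (rule LIMSEQ_le_const2, intro exI allI impI)
    show "\<beta> * (?q ^ k * (real t / (real t * B + 1 + ?n))) ^ ?n \<le> real (card K)" for t
      using bound[of t] by (simp only: times_divide_eq_right mult.commute)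
  qed
  moreover have "\<beta> * \<gamma> ^ ?n * ?q ^ ?n / (1 + 1 / ?q ^ (k - 1)) ^ ?n = \<beta> * (\<gamma> * ?q / (1 + 1 / ?q ^ (k - 1))) ^ ?n"
    by (simp add: power_divide power_mult_distrib)
  moreover have "\<beta> * (\<gamma> * ?q / (1 + 1 / ?q ^ (k - 1))) ^ ?n \<le> \<beta> * (?q ^ k * (1 / B)) ^ ?n"
  proof (intro mult_left_mono power_mono)
    obtain j where k: "k = Suc j" using assms(1) by (cases k) auto
    define c where "c = ?q ^ j"
    have c: "c > 0" by (simp add: c_def)
    \<comment> \<open>The limit is thus \<open>\<gamma> * ?q / (1 + \<gamma> / c)\<close>, which
      \<open>\<gamma> \<le> 1\<close> weakens to the stated form.\<close>
    have "B = (1 + \<gamma> / c) * (c / \<gamma>)"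
      using \<gamma> q c by (simp add: B_def k c_def field_simps)
    then have "?q ^ k * (1 / B) = \<gamma> * ?q / (1 + \<gamma> / c)"
      using \<gamma> c by (simp add: k c_def)
    moreover have "\<gamma> / c \<le> 1 / c" using assms(4) c by (intro divide_right_mono) auto
    moreover have "\<gamma> * ?q / (1 + 1 / c) \<le> \<gamma> * ?q / (1 + \<gamma> / c)"
      using \<gamma> q c \<open>\<gamma> / c \<le> 1 / c\<close> by (intro divide_left_mono mult_pos_pos add_pos_pos) auto
    ultimately show "\<gamma> * ?q / (1 + 1 / ?q ^ (k - 1)) \<le> ?q ^ k * (1 / B)"
      by (simp add: k c_def)
  next
    show "0 \<le> \<gamma> * ?q / (1 + 1 / ?q ^ (k - 1))"
      using assms(3) by (intro divide_nonneg_nonneg mult_nonneg_nonneg add_nonneg_nonneg) auto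
  qed (rule assms)
  ultimately show ?thesis by linarith
qed

end
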